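(* Let $m\in\mathbb N$, let $u_0\in L^2(\mathbb R^m)$, and let $u(x,t)=e^{itH}u_0(x)$ for $x\in\mathbb R^m$, $t\in\mathbb R$. Let $s\in\mathbb R$ and assume that for some $a,b>0$ one has $$\big\|e^{a|\cdot|^2}u(\cdot,0)\big\|_{L^2(\mathbb R^m)}+\big\|e^{b|\cdot|^2}u(\cdot,s)\big\|_{L^2(\mathbb R^m)}<\infty .$$ If $ab\,\sin^2 s\ge\frac1{16}$, then $u\equiv0$ in $\mathbb R^m\times\mathbb R$.
   Context: $H=\Delta-\frac{|x|^2}{4}$ is the harmonic oscillator on $\mathbb R^m$, regarded as a self-adjoint operator in $L^2(\mathbb R^m)$ (complex-valued functions, Lebesgue measure). $e^{itH}$, $t\in\mathbb R$, is the strongly continuous group of unitary operators in $L^2(\mathbb R^m)$ generated by $iH$ through Stone's theorem; it is the solution operator of the Cauchy problem $\partial_t u-iHu=0$, $u(x,0)=u_0(x)$. *)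

theory Defs
  imports "HOL-Analysis.Analysis"
begin

text \<open>Elements of \<open>L\<^sup>2\<close> are represented by complex-valued Lebesgue measurable functions; all
  identities between them are understood almost everywhere.\<close>

definition L2 :: "('a::euclidean_space \<Rightarrow> complex) set" where
  "L2 = {f \<in> borel_measurable lebesgue. integrable lebesgue (\<lambda>x. (cmod (f x))\<^sup>2)}"

text \<open>Meaningful for \<open>f \<in> L2\<close> only: the Bochner integral of a non-integrable function is \<open>0\<close>.\<close>

definition L2norm :: "('a::euclidean_space \<Rightarrow> complex) \<Rightarrow> real" where
  "L2norm f = sqrt (\<integral>x. (cmod (f x))\<^sup>2 \<partial>lebesgue)"

definition partial :: "'a::euclidean_space \<Rightarrow> ('a \<Rightarrow> complex) \<Rightarrow> 'a \<Rightarrow> complex" where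
  "partial i f x = frechet_derivative f (at x) i"

text \<open>Differentiability of all iterated partial derivatives makes \<open>f\<close> a \<open>C\<^sup>\<infinity>\<close> function.\<close>

definition Schwartz :: "('a::euclidean_space \<Rightarrow> complex) set" where
  "Schwartz = {f. \<forall>is \<in> lists Basis.
     (\<forall>x. foldr partial is f differentiable (at x)) \<and>
     (\<forall>k::nat. \<exists>C. \<forall>x. norm x ^ k * cmod (foldr partial is f x) \<le> C)}"

definition laplacian :: "('a::euclidean_space \<Rightarrow> complex) \<Rightarrow> 'a \<Rightarrow> complex" where
  "laplacian f x = (\<Sum>i\<in>Basis. partial i (partial i f) x)"

text \<open>Unbounded operators in \<open>L\<^sup>2\<close> are given by their graphs. The harmonic oscillator is the
  closure of \<open>\<Delta> - \<bar>x\<bar>\<^sup>2/4\<close> on Schwartz functions. This operator is essentially self-adjoint (the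
  Hermite functions are Schwartz functions and form an orthonormal basis of eigenfunctions), so
  its closure is its unique self-adjoint extension.\<close>

definition harmonic_oscillator ::
    "(('a::euclidean_space \<Rightarrow> complex) \<times> ('a \<Rightarrow> complex)) set" where
  "harmonic_oscillator = {(f, g). f \<in> L2 \<and> g \<in> L2 \<and>
     (\<exists>\<phi> :: nat \<Rightarrow> 'a \<Rightarrow> complex. (\<forall>n. \<phi> n \<in> Schwartz) \<and>
        (\<lambda>n. L2norm (\<lambda>x. \<phi> n x - f x)) \<longlonglongrightarrow> 0 \<and>
        (\<lambda>n. L2norm (\<lambda>x. (laplacian (\<phi> n) x - of_real ((norm x)\<^sup>2 / 4) * \<phi> n x) - g x))
          \<longlonglongrightarrow> 0)}"

text \<open>Linearity and isometry together imply that \<open>T\<close> respects almost everywhere equality.\<close>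

definition unitary_op ::
    "(('a::euclidean_space \<Rightarrow> complex) \<Rightarrow> ('a \<Rightarrow> complex)) \<Rightarrow> bool" where
  "unitary_op T \<longleftrightarrow>
     (\<forall>f\<in>L2. T f \<in> L2) \<and>
     (\<forall>f\<in>L2. \<forall>g\<in>L2. \<forall>c d :: complex. AE x in lebesgue.
        T (\<lambda>y. c * f y + d * g y) x = c * T f x + d * T g x) \<and>
     (\<forall>f\<in>L2. L2norm (T f) = L2norm f) \<and>
     (\<forall>g\<in>L2. \<exists>f\<in>L2. AE x in lebesgue. T f x = g x)"

definition unitary_group ::
    "(real \<Rightarrow> ('a::euclidean_space \<Rightarrow> complex) \<Rightarrow> ('a \<Rightarrow> complex)) \<Rightarrow> bool" where
  "unitary_group U \<longleftrightarrow>
     (\<forall>t. unitary_op (U t)) \<and>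
     (\<forall>f\<in>L2. AE x in lebesgue. U 0 f x = f x) \<and>
     (\<forall>f\<in>L2. \<forall>s t. AE x in lebesgue. U (s + t) f x = U s (U t f) x) \<and>
     (\<forall>f\<in>L2. \<forall>t. ((\<lambda>s. L2norm (\<lambda>x. U s f x - U t f x)) \<longlongrightarrow> 0) (at t))"

definition generator ::
    "(real \<Rightarrow> ('a::euclidean_space \<Rightarrow> complex) \<Rightarrow> ('a \<Rightarrow> complex))
      \<Rightarrow> (('a \<Rightarrow> complex) \<times> ('a \<Rightarrow> complex)) set" where
  "generator U = {(f, g). f \<in> L2 \<and> g \<in> L2 \<and>
     ((\<lambda>h. L2norm (\<lambda>x. (U h f x - f x) / of_real h - g x)) \<longlongrightarrow> 0) (at 0)}"

text \<open>\<open>U t = e\<^sup>i\<^sup>t\<^sup>H\<close>, where \<open>H\<close> is the harmonic oscillator. By Stone's theorem such a \<open>U\<close> exists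
  and is unique up to almost everywhere equality of the functions \<open>U t f\<close>, \<open>f \<in> L2\<close>.\<close>

definition harmonic_oscillator_group ::
    "(real \<Rightarrow> ('a::euclidean_space \<Rightarrow> complex) \<Rightarrow> ('a \<Rightarrow> complex)) \<Rightarrow> bool" where
  "harmonic_oscillator_group U \<longleftrightarrow>
     unitary_group U \<and>
     generator U = {(f, \<lambda>x. \<i> * g x) | f g. (f, g) \<in> harmonic_oscillator}"

end

theory Submission
  imports Defs "HOL-Probability.Probability" "HOL-Complex_Analysis.Complex_Analysis"
begin

text \<open>The coherent states \<open>exp (\<zeta> (x \<bullet> \<omega>) - \<bar>x\<bar>\<^sup>2 / 4)\<close> are Schwartz functions which the group \<open>e\<^sup>i\<^sup>t\<^sup>H\<close>
  permutes, up to a factor, by rotating \<open>\<zeta>\<close>. Pairing with them, the entire function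
  \<open>B f \<zeta> = exp (- \<zeta>\<^sup>2 / 2) \<integral> f x exp (\<zeta> (x \<bullet> \<omega>) - \<bar>x\<bar>\<^sup>2 / 4) dx\<close> satisfies
  \<open>\<bar>B u\<^sub>0 \<zeta>\<bar> = \<bar>B (e\<^sup>i\<^sup>s\<^sup>H u\<^sub>0) (e\<^sup>i\<^sup>s \<zeta>)\<bar>\<close>. The two decay hypotheses then bound the one function \<open>B u\<^sub>0\<close> by two
  Gaussians. After decreasing \<open>a\<close> one may assume \<open>a b sin\<^sup>2 s = 1/16\<close>, and in this case a rotation and a
  quadratic exponential factor turn the bounds into \<open>\<bar>E z\<bar> \<le> C exp (\<alpha> y\<^sup>2)\<close> and
  \<open>\<bar>E z\<bar> \<le> C exp (\<beta> x\<^sup>2)\<close>. By Phragmen--Lindelof in the four quadrants \<open>E\<close> is bounded, hence constant. The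
  constant is \<open>0\<close>, because a weight in \<open>L\<^sup>2\<close> gives slightly more than a bound: \<open>E\<close> tends to \<open>0\<close> along the real
  axis. So \<open>B u\<^sub>0\<close> vanishes for all \<open>\<omega>\<close>, and with it the Fourier transform of \<open>u\<^sub>0 x exp (- \<bar>x\<bar>\<^sup>2 / 4)\<close>.\<close>

section \<open>Entire functions with two Gaussian bounds\<close>

text \<open>Completing the square against the weight exp (a |x|^2) gives the growth exponent
  \<alpha> = 1 / (4 a + 1), so 1 - \<alpha> = 4 a \<alpha>. Hence a b sin^2 s = 1/16 says the same
  as (1 - \<alpha>) (1 - \<beta>) sin^2 s = \<alpha> \<beta>, and this is the condition under which
  one rotation aligns both Gaussian bounds with the axes. The obstacle is that order 2 is critical
  for a quadrant: exp (- \<i> z^2) has modulus exp (2 x y), bounded on both axes and unbounded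
  between them. Boundedness on the axes is therefore not enough. What helps is that the bounds also
  hold on nearby rays: \<alpha> y^2 is quadratic in the angle to the real axis, whereas the damping
  gained from \<epsilon> z^2, rotated to the diagonal, vanishes only linearly there. At equality the
  argument still admits a multiple of one Gaussian that attains the bound. To exclude it, the decay
  is recorded as a factor depending on Re \<zeta> that tends to 0, not merely as a constant.\<close>

lemma exists_angle_near_quarter_pi:
  fixes \<epsilon> M \<theta> :: real
  assumes "\<epsilon> > 0" "\<bar>\<theta>\<bar> < pi/4"
  obtains \<phi> where "\<bar>\<theta>\<bar> < \<phi>" "pi/8 < \<phi>" "\<phi> < pi/4" "M * (sin (pi/4 - \<phi>))\<^sup>2 \<le> \<epsilon> * cos (2*\<phi>)"
proof -
  have "((\<lambda>\<eta>. 2 * \<epsilon> * cos \<eta> - M * sin \<eta>) \<longlongrightarrow> 2 * \<epsilon> * cos 0 - M * sin 0) (at_right (0::real))"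
    by (intro tendsto_intros)
  then have "\<forall>\<^sub>F \<eta> in at_right 0. 0 < 2 * \<epsilon> * cos \<eta> - M * sin \<eta>"
    by (rule order_tendstoD) (use assms in auto)
  moreover have "\<forall>\<^sub>F \<eta> in at_right 0. \<eta> < min (pi/4 - \<bar>\<theta>\<bar>) (pi/8)"
    by (rule order_tendstoD[OF tendsto_ident_at]) (use assms in auto)
  moreover have "\<forall>\<^sub>F \<eta> in at_right (0::real). 0 < \<eta>"
    by (simp add: eventually_at_right_less)
  ultimately have "\<forall>\<^sub>F \<eta> in at_right 0. 0 < 2 * \<epsilon> * cos \<eta> - M * sin \<eta> \<and> \<eta> < min (pi/4 - \<bar>\<theta>\<bar>) (pi/8) \<and> 0 < \<eta>"
    by eventually_elim auto
  then obtain \<eta> where \<eta>: "0 < 2 * \<epsilon> * cos \<eta> - M * sin \<eta>" "\<eta> < pi/4 - \<bar>\<theta>\<bar>" "\<eta> < pi/8" "0 < \<eta>"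
    using eventually_happens[of _ "at_right (0::real)"] by force
  \<comment> \<open>With \<phi> = pi/4 - \<eta> the right-hand side is of first order in \<eta> and
    the left-hand side of second order, so any small \<eta> works, whatever \<epsilon> and
    \<open>M\<close> are.\<close>
  have "cos (2 * (pi/4 - \<eta>)) = sin (2 * \<eta>)"
    by (simp add: cos_sin_eq algebra_simps)
  then have c: "cos (2 * (pi/4 - \<eta>)) = 2 * sin \<eta> * cos \<eta>" by (simp add: sin_double)
  have s: "sin \<eta> \<ge> 0" using \<eta> pi_gt_zero by (intro sin_ge_zero) auto
  have "M * (sin \<eta>)\<^sup>2 \<le> \<epsilon> * (2 * sin \<eta> * cos \<eta>)"
    using mult_right_mono[of "M * sin \<eta>" "2 * \<epsilon> * cos \<eta>", OF _ s] \<eta> by (simp add: power2_eq_square algebra_simps)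
  then show thesis
    by (intro that[of "pi/4 - \<eta>"]) (use \<eta> c in auto)
qed

lemma Re_Im_quarter:
  "Re (cis (pi/4) * exp w) = exp (Re w) * cos (pi/4 + Im w)"
  "Im (cis (pi/4) * exp w) = exp (Re w) * sin (pi/4 + Im w)"
  by (simp_all add: Re_exp Im_exp cos_add sin_add algebra_simps)

text \<open>Phragmen--Lindelof in logarithmic coordinates, where the quadrant is a strip: \<open>exp (- \<epsilon> * exp (2 * w))\<close> makes
  the function bounded by \<open>C\<close> on two rays strictly inside the quadrant, and the
  sector between them is narrow enough for a noncritical exponent \<open>\<rho> > 2\<close>.\<close>

lemma quadrant_bound_interior:
  fixes E :: "complex \<Rightarrow> complex"
  assumes hol: "E holomorphic_on UNIV"
    and "\<alpha> \<ge> 0" "\<beta> \<ge> 0"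
    and bd1: "\<And>z. cmod (E z) \<le> C * exp (\<alpha> * (Im z)\<^sup>2)"
    and bd2: "\<And>z. cmod (E z) \<le> C * exp (\<beta> * (Re z)\<^sup>2)"
    and v: "\<bar>Im v\<bar> < pi/4"
  shows "cmod (E (cis (pi/4) * exp v)) \<le> C"
proof -
  \<comment> \<open>\<open>K\<close> is independent of \<epsilon>, although the exponent \<rho>
    chosen below is not: \<rho> never exceeds 3. This allows \<epsilon> to tend to 0 with
    \<open>v\<close> fixed.\<close>
  define K where "K = exp (2 * Re v) + exp (3 * \<bar>Re v\<bar>)"
  have C0: "C \<ge> 0"
    using order_trans[OF norm_ge_zero bd1[of 0]] by simp
  have key: "cmod (E (cis (pi/4) * exp v)) \<le> (1 + \<epsilon>) * C * exp (\<epsilon> * K)" if "\<epsilon> > 0" for \<epsilon>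
  proof -
    obtain \<phi> where \<phi>: "\<bar>Im v\<bar> < \<phi>" "pi/8 < \<phi>" "\<phi> < pi/4"
       "max \<alpha> \<beta> * (sin (pi/4 - \<phi>))\<^sup>2 \<le> \<epsilon> * cos (2*\<phi>)"
      using exists_angle_near_quarter_pi[OF \<open>\<epsilon> > 0\<close> v] by metis
    \<comment> \<open>This gives \<rho> \<phi> = \<phi> + pi/4 < pi/2, so the cosine in the second
      damping factor stays positive on the strip. From \<phi> < pi/4 follows \<rho> > 2, and from
      \<phi> > pi/8 follows \<rho> \<le> 3.\<close>
    define \<rho> where "\<rho> = 1 + pi / (4 * \<phi>)"
    have \<phi>0: "\<phi> > 0" using \<phi> pi_gt_zero by linarith
    have \<rho>: "\<rho> > 2" "\<rho> \<le> 3" "\<rho> * \<phi> < pi/2"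
      using \<phi> \<phi>0 by (auto simp: \<rho>_def field_simps)
    have cpos: "cos (\<rho> * \<phi>) > 0"
      using \<rho> \<phi>0 by (intro cos_gt_zero_pi) (auto intro: less_le_trans[of _ 0])
    \<comment> \<open>The edge Im w = - \<phi> is a ray close to the real axis, where Im z is small
      and \<open>bd1\<close> is the useful bound; the edge Im w = \<phi> is close to the imaginary
      axis and calls for \<open>bd2\<close>.\<close>
    have angle: "\<alpha> * (sin (pi/4 + \<theta>))\<^sup>2 \<le> \<epsilon> * cos (2*\<theta>)" if "\<theta> = -\<phi>" for \<theta>
      using \<phi>(4) that mult_right_mono[of \<alpha> "max \<alpha> \<beta>" "(sin (pi/4 - \<phi>))\<^sup>2"] by simp
    have angle': "\<beta> * (cos (pi/4 + \<theta>))\<^sup>2 \<le> \<epsilon> * cos (2*\<theta>)" if "\<theta> = \<phi>" for \<theta>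
    proof -
      have "cos (pi/4 + \<phi>) = sin (pi/4 - \<phi>)" by (simp add: cos_sin_eq algebra_simps)
      then show ?thesis
        using \<phi>(4) that mult_right_mono[of \<beta> "max \<alpha> \<beta>" "(sin (pi/4 - \<phi>))\<^sup>2"] by simp
    qed
    define h where "h = (\<lambda>w::complex. E (cis (pi/4) * exp w) * exp (- \<epsilon> * exp (2*w) - \<epsilon> * exp (\<rho> * w)))"
    have cmod_h: "cmod (h w) = cmod (E (cis (pi/4) * exp w)) *
        exp (- (\<epsilon> * exp (2 * Re w) * cos (2 * Im w)) - \<epsilon> * exp (\<rho> * Re w) * cos (\<rho> * Im w))" for w :: complex
      by (simp add: h_def norm_mult Re_exp)
    have cosbd: "cos (\<rho> * Im w) \<ge> cos (\<rho> * \<phi>)" "cos (2 * Im w) \<ge> 0" if "\<bar>Im w\<bar> \<le> \<phi>" for w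
    proof -
      have "\<rho> * \<phi> \<le> pi" using \<rho>(3) pi_gt_zero by linarith
      then have "cos (\<rho> * \<bar>Im w\<bar>) \<ge> cos (\<rho> * \<phi>)"
        using that \<rho>(1,2) \<phi>0 by (intro cos_monotone_0_pi_le mult_left_mono mult_nonneg_nonneg) auto
      moreover have "cos (\<rho> * \<bar>Im w\<bar>) = cos (\<rho> * Im w)" by (auto simp: abs_if)
      ultimately show "cos (\<rho> * Im w) \<ge> cos (\<rho> * \<phi>)" by simp
      show "cos (2 * Im w) \<ge> 0" using that \<phi> by (intro cos_ge_zero) auto
    qed
    have hbd: "cmod (h w) \<le> C * exp (\<alpha> * (exp (Re w))\<^sup>2 * (sin (pi/4 + Im w))\<^sup>2
                 - \<epsilon> * (exp (Re w))\<^sup>2 * cos (2 * Im w) - \<epsilon> * exp (\<rho> * Re w) * cos (\<rho> * \<phi>))"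
        "cmod (h w) \<le> C * exp (\<beta> * (exp (Re w))\<^sup>2 * (cos (pi/4 + Im w))\<^sup>2
                 - \<epsilon> * (exp (Re w))\<^sup>2 * cos (2 * Im w) - \<epsilon> * exp (\<rho> * Re w) * cos (\<rho> * \<phi>))"
      if w: "\<bar>Im w\<bar> \<le> \<phi>" for w
    proof -
      define L where "L = - (\<epsilon> * exp (2 * Re w) * cos (2 * Im w)) - \<epsilon> * exp (\<rho> * Re w) * cos (\<rho> * Im w)"
      have L: "L \<le> - (\<epsilon> * (exp (Re w))\<^sup>2 * cos (2 * Im w)) - \<epsilon> * exp (\<rho> * Re w) * cos (\<rho> * \<phi>)"
        using cosbd[OF w] that \<open>\<epsilon> > 0\<close> by (simp add: L_def exp_double)
      have "cmod (h w) \<le> C * exp (\<alpha> * (exp (Re w) * sin (pi/4 + Im w))\<^sup>2) * exp L"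
        unfolding cmod_h L_def[symmetric]
        using bd1[of "cis (pi/4) * exp w"] by (intro mult_right_mono) (auto simp only: Re_Im_quarter exp_ge_zero)
      also have "\<dots> = C * exp (\<alpha> * (exp (Re w) * sin (pi/4 + Im w))\<^sup>2 + L)"
        by (simp add: exp_add)
      also have "\<dots> \<le> C * exp (\<alpha> * (exp (Re w))\<^sup>2 * (sin (pi/4 + Im w))\<^sup>2
                 - \<epsilon> * (exp (Re w))\<^sup>2 * cos (2 * Im w) - \<epsilon> * exp (\<rho> * Re w) * cos (\<rho> * \<phi>))"
        using L C0 by (intro mult_left_mono) (auto simp: power_mult_distrib)
      finally show "cmod (h w) \<le> C * exp (\<alpha> * (exp (Re w))\<^sup>2 * (sin (pi/4 + Im w))\<^sup>2
                 - \<epsilon> * (exp (Re w))\<^sup>2 * cos (2 * Im w) - \<epsilon> * exp (\<rho> * Re w) * cos (\<rho> * \<phi>))" .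
      have "cmod (h w) \<le> C * exp (\<beta> * (exp (Re w) * cos (pi/4 + Im w))\<^sup>2) * exp L"
        unfolding cmod_h L_def[symmetric]
        using bd2[of "cis (pi/4) * exp w"] by (intro mult_right_mono) (auto simp only: Re_Im_quarter exp_ge_zero)
      also have "\<dots> = C * exp (\<beta> * (exp (Re w) * cos (pi/4 + Im w))\<^sup>2 + L)"
        by (simp add: exp_add)
      also have "\<dots> \<le> C * exp (\<beta> * (exp (Re w))\<^sup>2 * (cos (pi/4 + Im w))\<^sup>2
                 - \<epsilon> * (exp (Re w))\<^sup>2 * cos (2 * Im w) - \<epsilon> * exp (\<rho> * Re w) * cos (\<rho> * \<phi>))"
        using L C0 by (intro mult_left_mono) (auto simp: power_mult_distrib)
      finally show "cmod (h w) \<le> C * exp (\<beta> * (exp (Re w))\<^sup>2 * (cos (pi/4 + Im w))\<^sup>2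
                 - \<epsilon> * (exp (Re w))\<^sup>2 * cos (2 * Im w) - \<epsilon> * exp (\<rho> * Re w) * cos (\<rho> * \<phi>))" .
    qed
    \<comment> \<open>Because \<rho> > 2, the second damping term outweighs \<alpha> exp (2 r) for
      large r, uniformly across the strip. This fixes the right edge of a rectangle to which the
      maximum principle applies.\<close>
    have "filterlim (\<lambda>r. (\<rho> - 2) * r) at_top at_top"
      using \<rho>(1) by (intro filterlim_tendsto_pos_mult_at_top[OF tendsto_const] filterlim_ident) auto
    then have "filterlim (\<lambda>r. exp ((\<rho> - 2) * r)) at_top at_top"
      by (rule filterlim_compose[OF exp_at_top])
    then have "\<forall>\<^sub>F r in at_top. \<alpha> / (\<epsilon> * cos (\<rho> * \<phi>)) \<le> exp ((\<rho> - 2) * r)"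
      by (simp add: filterlim_at_top)
    with eventually_ge_at_top[of "Re v"] have "\<forall>\<^sub>F r in at_top. Re v \<le> r \<and> \<alpha> / (\<epsilon> * cos (\<rho> * \<phi>)) \<le> exp ((\<rho> - 2) * r)"
      by eventually_elim auto
    then obtain R where R: "Re v \<le> R" and R': "\<alpha> / (\<epsilon> * cos (\<rho> * \<phi>)) \<le> exp ((\<rho> - 2) * R)"
      using eventually_happens[of _ "at_top::real filter"] by force
    have "\<alpha> \<le> \<epsilon> * cos (\<rho> * \<phi>) * exp ((\<rho> - 2) * R)"
      using R' cpos that by (simp add: field_simps)
    from mult_right_mono[OF this, of "exp (2 * R)"]
    have R2: "\<alpha> * (exp R)\<^sup>2 - \<epsilon> * exp (\<rho> * R) * cos (\<rho> * \<phi>) \<le> 0"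
      unfolding exp_double[symmetric] by (simp add: algebra_simps flip: exp_add)
    \<comment> \<open>The left edge is a small arc around the origin, where \<open>bd1\<close> costs
      only a factor 1 + \<epsilon>.\<close>
    have "((\<lambda>r. exp (\<alpha> * (exp r)\<^sup>2)) \<longlongrightarrow> exp (\<alpha> * 0\<^sup>2)) at_bot"
      by (intro tendsto_intros exp_at_bot)
    then have "\<forall>\<^sub>F r in at_bot. exp (\<alpha> * (exp r)\<^sup>2) < 1 + \<epsilon>"
      by (rule order_tendstoD) (use that in auto)
    with eventually_le_at_bot[of "Re v"] have "\<forall>\<^sub>F r in at_bot. r \<le> Re v \<and> exp (\<alpha> * (exp r)\<^sup>2) < 1 + \<epsilon>"
      by eventually_elim auto
    then obtain L where L: "L \<le> Re v" "exp (\<alpha> * (exp L)\<^sup>2) < 1 + \<epsilon>"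
      using eventually_happens[of _ "at_bot::real filter"] by force
    define S where "S = cbox (Complex L (-\<phi>)) (Complex R \<phi>)"
    have hol_h: "h holomorphic_on UNIV"
      unfolding h_def
      by (intro holomorphic_intros holomorphic_on_compose_gen[OF _ hol, unfolded o_def]) auto
    have "cmod (h v) \<le> (1 + \<epsilon>) * C"
    proof (rule maximum_modulus_frontier[of h S])
      show "h holomorphic_on interior S" using hol_h by (rule holomorphic_on_subset) auto
      show "continuous_on (closure S) h"
        using hol_h holomorphic_on_imp_continuous_on continuous_on_subset by blast
      show "bounded S" by (simp add: S_def)
      show "v \<in> S" using R L \<phi> by (auto simp: S_def in_cbox_complex_iff)
      fix w assume "w \<in> frontier S"
      then have w: "w \<in> S" "w \<notin> interior S"
        by (auto simp: frontier_def S_def)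
      then have im: "\<bar>Im w\<bar> \<le> \<phi>" by (auto simp: S_def in_cbox_complex_iff)
      have case_split: "Re w = L \<or> Re w = R \<or> Im w = \<phi> \<or> Im w = -\<phi>"
        using w by (auto simp: S_def in_cbox_complex_iff interior_cbox in_box_complex_iff)
      have C1: "C * exp t \<le> (1 + \<epsilon>) * C" if "exp t \<le> 1 + \<epsilon>" for t
        using that C0 by (metis mult.commute mult_right_mono)
      have sin1: "(sin (pi/4 + Im w))\<^sup>2 \<le> 1" by (simp add: abs_square_le_1)
      have pos: "\<epsilon> * (exp (Re w))\<^sup>2 * cos (2 * Im w) \<ge> 0" "\<epsilon> * exp (\<rho> * Re w) * cos (\<rho> * \<phi>) \<ge> 0"
        using cosbd[OF im] cpos that by auto
      have al: "\<alpha> * (exp (Re w))\<^sup>2 * (sin (pi/4 + Im w))\<^sup>2 \<le> \<alpha> * (exp (Re w))\<^sup>2"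
        using mult_left_mono[OF sin1, of "\<alpha> * (exp (Re w))\<^sup>2"] \<open>\<alpha> \<ge> 0\<close> by simp
      from case_split consider "Re w = L" | "Re w = R" | "Im w = \<phi>" | "Im w = -\<phi>" by blast
      then show "cmod (h w) \<le> (1 + \<epsilon>) * C"
      proof cases
        case 1
        have "\<alpha> * (exp (Re w))\<^sup>2 * (sin (pi/4 + Im w))\<^sup>2
                 - \<epsilon> * (exp (Re w))\<^sup>2 * cos (2 * Im w) - \<epsilon> * exp (\<rho> * Re w) * cos (\<rho> * \<phi>) \<le> \<alpha> * (exp L)\<^sup>2"
          using al pos 1 by simp
        with L(2) show ?thesis by (intro order_trans[OF hbd(1)[OF im] C1]) (smt (verit) exp_le_cancel_iff)
      next
        case 2
        have "\<alpha> * (exp (Re w))\<^sup>2 * (sin (pi/4 + Im w))\<^sup>2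
                 - \<epsilon> * (exp (Re w))\<^sup>2 * cos (2 * Im w) - \<epsilon> * exp (\<rho> * Re w) * cos (\<rho> * \<phi>) \<le> 0"
          using al pos(1) R2 unfolding 2 by linarith
        with that show ?thesis by (intro order_trans[OF hbd(1)[OF im] C1]) (smt (verit) exp_le_one_iff)
      next
        case 3
        have "(exp (Re w))\<^sup>2 * (\<beta> * (cos (pi/4 + Im w))\<^sup>2) \<le> (exp (Re w))\<^sup>2 * (\<epsilon> * cos (2 * Im w))"
          using angle'[OF 3] by (intro mult_left_mono) auto
        then have "\<beta> * (exp (Re w))\<^sup>2 * (cos (pi/4 + Im w))\<^sup>2
                 - \<epsilon> * (exp (Re w))\<^sup>2 * cos (2 * Im w) - \<epsilon> * exp (\<rho> * Re w) * cos (\<rho> * \<phi>) \<le> 0"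
          using pos(2) by (simp only: mult_ac)
        with that show ?thesis by (intro order_trans[OF hbd(2)[OF im] C1]) (smt (verit) exp_le_one_iff)
      next
        case 4
        have "(exp (Re w))\<^sup>2 * (\<alpha> * (sin (pi/4 + Im w))\<^sup>2) \<le> (exp (Re w))\<^sup>2 * (\<epsilon> * cos (2 * Im w))"
          using angle[OF 4] by (intro mult_left_mono) auto
        then have "\<alpha> * (exp (Re w))\<^sup>2 * (sin (pi/4 + Im w))\<^sup>2
                 - \<epsilon> * (exp (Re w))\<^sup>2 * cos (2 * Im w) - \<epsilon> * exp (\<rho> * Re w) * cos (\<rho> * \<phi>) \<le> 0"
          using pos(2) by (simp only: mult_ac)
        with that show ?thesis by (intro order_trans[OF hbd(1)[OF im] C1]) (smt (verit) exp_le_one_iff)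
      qed
    qed
    moreover have "cmod (E (cis (pi/4) * exp v)) = cmod (h v) *
        exp (\<epsilon> * exp (2 * Re v) * cos (2 * Im v) + \<epsilon> * exp (\<rho> * Re v) * cos (\<rho> * Im v))"
      by (simp add: cmod_h mult.assoc flip: exp_add)
    moreover have "\<epsilon> * exp (2 * Re v) * cos (2 * Im v) + \<epsilon> * exp (\<rho> * Re v) * cos (\<rho> * Im v) \<le> \<epsilon> * K"
    proof -
      have "\<rho> * Re v \<le> \<rho> * \<bar>Re v\<bar>" using \<rho> by (intro mult_left_mono) auto
      also have "\<dots> \<le> 3 * \<bar>Re v\<bar>" using \<rho> by (intro mult_right_mono) auto
      finally have "exp (\<rho> * Re v) * cos (\<rho> * Im v) \<le> exp (3 * \<bar>Re v\<bar>) * 1"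
        by (intro order_trans[OF mult_left_mono[OF cos_le_one]]) auto
      moreover have "exp (2 * Re v) * cos (2 * Im v) \<le> exp (2 * Re v) * 1"
        by (intro mult_left_mono) auto
      ultimately have "exp (2 * Re v) * cos (2 * Im v) + exp (\<rho> * Re v) * cos (\<rho> * Im v) \<le> K"
        unfolding K_def by linarith
      from mult_left_mono[OF this, of \<epsilon>] that show ?thesis by (simp add: algebra_simps)
    qed
    ultimately show ?thesis
      using C0 that by (auto intro!: mult_mono)
  qed
  have "((\<lambda>\<epsilon>. (1 + \<epsilon>) * C * exp (\<epsilon> * K)) \<longlongrightarrow> (1 + 0) * C * exp (0 * K)) (at_right 0)"
    by (intro tendsto_intros)
  then have "cmod (E (cis (pi / 4) * exp v)) \<le> (1 + 0) * C * exp (0 * K)"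
    by (rule tendsto_lowerbound) (auto intro!: eventually_at_rightI[of 0 1] key)
  then show ?thesis by simp
qed

lemma cos_pos_imp_abs_less:
  assumes "cos x > 0" "\<bar>x\<bar> \<le> pi"
  shows "\<bar>x\<bar> < pi/2"
proof (rule ccontr)
  assume "\<not> \<bar>x\<bar> < pi/2"
  then have "cos \<bar>x\<bar> \<le> cos (pi/2)"
    using assms(2) by (intro cos_monotone_0_pi_le) auto
  then show False using assms(1) by simp
qed

lemma quadrant_bound:
  fixes E :: "complex \<Rightarrow> complex"
  assumes "E holomorphic_on UNIV" "\<alpha> \<ge> 0" "\<beta> \<ge> 0"
    and bd1: "\<And>z. cmod (E z) \<le> C * exp (\<alpha> * (Im z)\<^sup>2)"
    and bd2: "\<And>z. cmod (E z) \<le> C * exp (\<beta> * (Re z)\<^sup>2)"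
    and z: "Re z \<ge> 0" "Im z \<ge> 0"
  shows "cmod (E z) \<le> C"
proof (cases "Re z = 0 \<or> Im z = 0")
  case True
  then show ?thesis using bd1[of z] bd2[of z] by auto
next
  case False
  \<comment> \<open>Rotation by - pi/4 centres the quadrant on the positive real axis, where its
    interior is |Im| < Re; the principal logarithm maps this to the strip |Im v| < pi/4.\<close>
  define v where "v = Ln (cis (-(pi/4)) * z)"
  have nz: "z \<noteq> 0" using False by auto
  then have ev: "exp v = cis (-(pi/4)) * z" by (simp add: v_def)
  then have zv: "z = cis (pi/4) * exp v" by (simp add: cis_mult flip: mult.assoc)
  have "Re (exp v) = (Re z + Im z) * (sqrt 2 / 2)" "Im (exp v) = (Im z - Re z) * (sqrt 2 / 2)"
    by (simp_all add: ev cos_45 sin_45 algebra_simps)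
  moreover have "\<bar>Im z - Re z\<bar> < Re z + Im z"
    using False z by (auto simp: abs_if)
  then have "\<bar>Im z - Re z\<bar> * (sqrt 2 / 2) < (Re z + Im z) * (sqrt 2 / 2)"
    by (intro mult_strict_right_mono) auto
  ultimately have "\<bar>Im (exp v)\<bar> < Re (exp v)"
    by (simp only: abs_mult) simp
  then have "exp (Re v) * \<bar>sin (Im v)\<bar> < exp (Re v) * cos (Im v)"
    by (simp add: Re_exp Im_exp abs_mult)
  then have sc: "\<bar>sin (Im v)\<bar> < cos (Im v)" by simp
  then have "(sin (Im v))\<^sup>2 < (cos (Im v))\<^sup>2" using power_strict_mono[OF sc, of 2] by simp
  \<comment> \<open>This alone determines Im v only modulo pi. The positive cosine of Im v and the
    principal branch first confine it to |Im v| < pi/2.\<close>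
  then have "cos (2 * Im v) > 0" by (simp add: cos_double)
  moreover have "\<bar>Im v\<bar> \<le> pi"
    using Im_Ln_le_pi[of "cis (-(pi/4)) * z"] mpi_less_Im_Ln[of "cis (-(pi/4)) * z"] nz by (simp add: v_def abs_le_iff)
  then have "\<bar>Im v\<bar> < pi/2" using sc by (intro cos_pos_imp_abs_less) auto
  ultimately have "\<bar>2 * Im v\<bar> < pi/2" by (intro cos_pos_imp_abs_less) auto
  then have "\<bar>Im v\<bar> < pi/4" by (simp add: abs_mult)
  from quadrant_bound_interior[OF assms(1-5) this] show ?thesis by (simp add: zv)
qed

text \<open>Multiplying the variable by -1 preserves both bounds and multiplying it by \<i> or -
  \<i> exchanges them, so every quadrant reduces to the first.\<close>

lemma bounded_by_two_exponentials:
  fixes E :: "complex \<Rightarrow> complex"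
  assumes hol: "E holomorphic_on UNIV" and "\<alpha> \<ge> 0" "\<beta> \<ge> 0"
    and bd1: "\<And>z. cmod (E z) \<le> C * exp (\<alpha> * (Im z)\<^sup>2)"
    and bd2: "\<And>z. cmod (E z) \<le> C * exp (\<beta> * (Re z)\<^sup>2)"
  shows "cmod (E z) \<le> C"
proof -
  have h: "(\<lambda>z. E (c * z)) holomorphic_on UNIV" for c
    by (intro holomorphic_on_compose_gen[OF _ hol, unfolded o_def] holomorphic_intros) auto
  consider "Re z \<ge> 0" "Im z \<ge> 0" | "Re z \<le> 0" "Im z \<le> 0" | "Re z \<ge> 0" "Im z \<le> 0" | "Re z \<le> 0" "Im z \<ge> 0"
    by linarith
  then show ?thesis
  proof cases
    case 1
    then show ?thesis using quadrant_bound[OF assms] by blast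
  next
    case 2
    then show ?thesis
      using quadrant_bound[OF h[of "-1"] assms(2,3), of C "-z"] bd1[of "- _"] bd2[of "- _"] by simp
  next
    case 3
    then show ?thesis
      using quadrant_bound[OF h[of "-\<i>"] assms(3,2), of C "\<i> * z"] bd1[of "-\<i> * _"] bd2[of "-\<i> * _"] by (simp flip: mult.assoc)
  next
    case 4
    then show ?thesis
      using quadrant_bound[OF h[of "\<i>"] assms(3,2), of C "-\<i> * z"] bd1[of "\<i> * _"] bd2[of "\<i> * _"] by (simp flip: mult.assoc)
  qed
qed

text \<open>The rotation \<open>\<tau>\<close> and the Gaussian factor \<open>exp (- c * z\<^sup>2 / 2)\<close> turn the two bounds into the ones of
  \<open>bounded_by_two_exponentials\<close>; this is possible exactly in the critical case.\<close>

lemma critical_growth_imp_gaussian: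
  fixes B :: "complex \<Rightarrow> complex" and \<alpha> \<beta> s :: real
  assumes hol: "B holomorphic_on UNIV" and \<alpha>: "0 < \<alpha>" "\<alpha> < 1" and \<beta>: "0 < \<beta>" "\<beta> < 1"
    and crit: "(1 - \<alpha>) * (1 - \<beta>) * (sin s)\<^sup>2 = \<alpha> * \<beta>"
    and bd1: "\<And>z. cmod (B z) \<le> C * exp (\<alpha> * (Re z)\<^sup>2 - Re (z\<^sup>2) / 2)"
    and bd2: "\<And>z. cmod (B z) \<le> C * exp (\<beta> * (Re (cis s * z))\<^sup>2 - Re ((cis s * z)\<^sup>2) / 2)"
  obtains \<tau> c k where "cmod \<tau> = 1" "Re \<tau> \<noteq> 0" "\<And>z. B (\<tau> * z) = k * exp (c * z\<^sup>2)"
    "\<And>r. Re (c * (complex_of_real r)\<^sup>2) = \<alpha> * (Re (\<tau> * of_real r))\<^sup>2 - Re ((\<tau> * of_real r)\<^sup>2) / 2"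
proof -
  \<comment> \<open>In terms of |z|^2 and z^2, the two rotated bounds become \<alpha> (Im z)^2 and
    \<beta> (Re z)^2 after removal of the same Gaussian exactly when \<alpha> - (1 - \<alpha>)
    \<tau>^2 = - \<beta> - (1 - \<beta>) cis(s)^2 \<tau>^2, that is, \<tau>^2 D = \<alpha> +
    \<beta>. A solution of modulus 1 requires |D| = \<alpha> + \<beta>, and this is what
    \<open>crit\<close> supplies.\<close>
  define D where "D = complex_of_real (1 - \<alpha>) - of_real (1 - \<beta>) * (cis s)\<^sup>2"
  have cis2: "(cis s)\<^sup>2 = Complex (cos (2 * s)) (sin (2 * s))"
    by (simp add: cis.ctr complex_eq_iff cos_double sin_double power2_eq_square)
  have "(cmod D)\<^sup>2 = (1 - \<alpha> - (1 - \<beta>) * cos (2 * s))\<^sup>2 + ((1 - \<beta>) * sin (2 * s))\<^sup>2"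
    by (simp add: D_def cis2 cmod_power2)
  also have "\<dots> = (1 - \<alpha>)\<^sup>2 - 2 * (1 - \<alpha>) * (1 - \<beta>) * cos (2 * s) + (1 - \<beta>)\<^sup>2 * ((sin (2 * s))\<^sup>2 + (cos (2 * s))\<^sup>2)"
    by algebra
  also have "\<dots> = (\<alpha> - \<beta>)\<^sup>2 + 4 * ((1 - \<alpha>) * (1 - \<beta>) * (sin s)\<^sup>2)"
    unfolding sin_cos_squared_add by (simp only: cos_double_sin) (simp add: power2_eq_square algebra_simps)
  also have "\<dots> = (\<alpha> + \<beta>)\<^sup>2"
    unfolding crit by (simp add: power2_eq_square algebra_simps)
  finally have modD: "cmod D = \<alpha> + \<beta>" using \<alpha> \<beta> by (simp add: power2_eq_iff_nonneg)
  have Dnz: "D \<noteq> 0" using modD \<alpha> \<beta> by auto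
  define \<tau> where "\<tau> = csqrt (of_real (\<alpha> + \<beta>) / D)"
  have \<tau>2: "\<tau>\<^sup>2 * D = of_real (\<alpha> + \<beta>)" using Dnz by (simp add: \<tau>_def)
  have mod\<tau>: "cmod \<tau> = 1"
  proof -
    have "cmod (\<tau>\<^sup>2) = 1" unfolding \<tau>_def power2_csqrt using \<alpha> \<beta> by (simp add: norm_divide modD del: of_real_add)
    then show ?thesis by (simp add: norm_power power2_eq_1_iff) (smt (verit) norm_ge_zero)
  qed
  define c where "c = of_real \<alpha> - of_real (1 - \<alpha>) * \<tau>\<^sup>2"
  have c2: "c = - of_real \<beta> - of_real (1 - \<beta>) * (cis s)\<^sup>2 * \<tau>\<^sup>2"
    using \<tau>2 unfolding c_def D_def by (simp add: algebra_simps)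
  have sq: "(Re z)\<^sup>2 = ((cmod z)\<^sup>2 + Re (z\<^sup>2)) / 2" "(Im z)\<^sup>2 = ((cmod z)\<^sup>2 - Re (z\<^sup>2)) / 2" for z
    by (simp_all add: cmod_power2 Re_power2)
  have e1: "\<alpha> * (Re (\<tau> * z))\<^sup>2 - Re ((\<tau> * z)\<^sup>2) / 2 = \<alpha> * (Im z)\<^sup>2 + Re (c * z\<^sup>2 / 2)" for z
    unfolding sq by (simp add: c_def norm_mult mod\<tau> power_mult_distrib algebra_simps diff_divide_distrib add_divide_distrib)
  have e2: "\<beta> * (Re (cis s * (\<tau> * z)))\<^sup>2 - Re ((cis s * (\<tau> * z))\<^sup>2) / 2 = \<beta> * (Re z)\<^sup>2 + Re (c * z\<^sup>2 / 2)" for z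
    unfolding sq by (simp add: c2 norm_mult mod\<tau> power_mult_distrib algebra_simps diff_divide_distrib add_divide_distrib)
  define E where "E = (\<lambda>z. B (\<tau> * z) * exp (- (c * z\<^sup>2 / 2)))"
  have holE: "E holomorphic_on UNIV" unfolding E_def
    by (intro holomorphic_on_compose_gen[OF _ hol, unfolded o_def] holomorphic_intros) auto
  have E1: "cmod (E z) \<le> C * exp (\<alpha> * (Im z)\<^sup>2)" for z
  proof -
    have "cmod (E z) \<le> C * exp (\<alpha> * (Im z)\<^sup>2 + Re (c * z\<^sup>2 / 2)) * exp (- Re (c * z\<^sup>2 / 2))"
      using bd1[of "\<tau> * z"] unfolding E_def norm_mult e1 norm_exp_eq_Re uminus_complex.sel by (intro mult_right_mono) auto
    then show ?thesis by (simp add: mult.assoc flip: exp_add)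
  qed
  have E2: "cmod (E z) \<le> C * exp (\<beta> * (Re z)\<^sup>2)" for z
  proof -
    have "cmod (E z) \<le> C * exp (\<beta> * (Re z)\<^sup>2 + Re (c * z\<^sup>2 / 2)) * exp (- Re (c * z\<^sup>2 / 2))"
      using bd2[of "\<tau> * z"] unfolding E_def norm_mult e2 norm_exp_eq_Re uminus_complex.sel by (intro mult_right_mono) auto
    then show ?thesis by (simp add: mult.assoc flip: exp_add)
  qed
  have "cmod (E z) \<le> C" for z
    using bounded_by_two_exponentials[OF holE _ _ E1 E2] \<alpha> \<beta> by simp
  then have "bounded (range E)" by (auto simp: bounded_iff)
  then obtain k where k: "E z = k" for z
    using Liouville_theorem[OF holE] by (auto simp: constant_on_def)
  \<comment> \<open>The coefficient returned is half of the local \<open>c\<close>. On the real axis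
    the term \<alpha> (Im z)^2 drops out of \<open>e1\<close>, so there the Gaussian has exactly the
    growth that the first bound allows.\<close>
  have "B (\<tau> * z) = k * exp (c / 2 * z\<^sup>2)" for z
    using k[of z] by (simp add: E_def exp_minus field_simps)
  moreover have "Re (c / 2 * (complex_of_real r)\<^sup>2) = \<alpha> * (Re (\<tau> * of_real r))\<^sup>2 - Re ((\<tau> * of_real r)\<^sup>2) / 2" for r
    unfolding e1 by simp
  \<comment> \<open>The decay will be exploited along the line through \<tau>, and it is a decay in
    the real part. An imaginary \<tau> would force 1 - \<beta> = 1 + \<beta>.\<close>
  moreover have "Re \<tau> \<noteq> 0"
  proof
    assume "Re \<tau> = 0"
    then have "\<tau>\<^sup>2 = -1"
      using mod\<tau> by (simp add: complex_eq_iff cmod_def Re_power2 Im_power2 abs_square_eq_1)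
    then have "of_real (1 - \<beta>) * (cis s)\<^sup>2 = complex_of_real (1 + \<beta>)"
      using \<tau>2 by (simp add: D_def algebra_simps)
    then have "cmod (of_real (1 - \<beta>) * (cis s)\<^sup>2) = 1 + \<beta>" 
      using \<beta> by (simp only: norm_of_real)
    then show False using \<beta> by (simp add: norm_mult norm_power del: of_real_diff)
  qed
  ultimately show thesis using mod\<tau> that by blast
qed

section \<open>Square-integrable functions\<close>

lemma L2_D: 
  assumes "f \<in> L2"
  shows "f \<in> borel_measurable lebesgue" "integrable lebesgue (\<lambda>x. (cmod (f x))\<^sup>2)"
  using assms by (auto simp: L2_def)

lemma integrable_by_bound:
  fixes f :: "'a \<Rightarrow> 'b::{banach, second_countable_topology}" and w :: "'a \<Rightarrow> real"
  assumes "integrable M w" "f \<in> borel_measurable M" "\<And>x. norm (f x) \<le> w x"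
  shows "integrable M f"
  by (rule Bochner_Integration.integrable_bound[OF assms(1,2)]) (auto intro!: AE_I2 order_trans[OF assms(3)])

lemma L2_bound:
  assumes "g \<in> L2" "f \<in> borel_measurable lebesgue" "\<And>x. cmod (f x) \<le> cmod (g x)"
  shows "f \<in> L2"
proof -
  have "integrable lebesgue (\<lambda>x. (cmod (f x))\<^sup>2)"
    by (rule Bochner_Integration.integrable_bound[OF L2_D(2)[OF assms(1)]]) (use assms in \<open>auto intro!: AE_I2 power_mono\<close>)
  then show ?thesis using assms by (simp add: L2_def)
qed

lemma L2_cmult: "f \<in> L2 \<Longrightarrow> (\<lambda>x. c * f x) \<in> L2"
  by (auto simp: L2_def norm_mult power_mult_distrib)

lemma L2_add:
  assumes "f \<in> L2" "g \<in> L2" 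
  shows "(\<lambda>x. f x + g x) \<in> L2"
proof -
  note [measurable] = L2_D(1)[OF assms(1)] L2_D(1)[OF assms(2)]
  have "(cmod (f x + g x))\<^sup>2 \<le> 2 * (cmod (f x))\<^sup>2 + 2 * (cmod (g x))\<^sup>2" for x
  proof -
    have "(cmod (f x + g x))\<^sup>2 \<le> (cmod (f x) + cmod (g x))\<^sup>2"
      by (intro power_mono norm_triangle_ineq) auto
    also have "\<dots> \<le> 2 * (cmod (f x))\<^sup>2 + 2 * (cmod (g x))\<^sup>2"
      using sum_squares_bound[of "cmod (f x)" "cmod (g x)"] by (simp add: power2_sum)
    finally show ?thesis .
  qed
  then have "integrable lebesgue (\<lambda>x. (cmod (f x + g x))\<^sup>2)"
    by (intro integrable_by_bound[where w = "\<lambda>x. 2 * (cmod (f x))\<^sup>2 + 2 * (cmod (g x))\<^sup>2"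
          and f = "\<lambda>x. (cmod (f x + g x))\<^sup>2"])
       (simp_all add: L2_D(2) assms)
  then show ?thesis by (simp add: L2_def)
qed

lemma L2_diff:
  assumes "f \<in> L2" "g \<in> L2"
  shows "(\<lambda>x. f x - g x) \<in> L2"
  using L2_add[OF assms(1) L2_cmult[OF assms(2), of "-1"]] by simp

lemma L2_cnj:
  assumes "f \<in> L2"
  shows "(\<lambda>x. cnj (f x)) \<in> L2"
proof (rule L2_bound[OF assms])
  show "(\<lambda>x. cnj (f x)) \<in> borel_measurable lebesgue"
    by (rule measurable_compose[OF L2_D(1)[OF assms]])
       (intro borel_measurable_continuous_onI continuous_on_cnj continuous_on_id)
qed simp

lemma L2_integrable_mult:
  assumes "f \<in> L2" "g \<in> L2"
  shows "integrable lebesgue (\<lambda>x. f x * g x)"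
proof -
  note [measurable] = L2_D(1)[OF assms(1)] L2_D(1)[OF assms(2)]
  have "cmod (f x * g x) \<le> (cmod (f x))\<^sup>2 + (cmod (g x))\<^sup>2" for x
  proof -
    have "cmod (f x) * cmod (g x) \<ge> 0" by simp
    then show ?thesis
      using sum_squares_bound[of "cmod (f x)" "cmod (g x)"] unfolding norm_mult by linarith
  qed
  then show ?thesis
    by (rule integrable_by_bound[where w = "\<lambda>x. (cmod (f x))\<^sup>2 + (cmod (g x))\<^sup>2", rotated 2])
       (simp_all add: L2_D(2) assms)
qed

lemma L2norm_nonneg [simp]: "0 \<le> L2norm f"
  by (simp add: L2norm_def)

lemma L2norm_power2: "(L2norm f)\<^sup>2 = (\<integral>x. (cmod (f x))\<^sup>2 \<partial>lebesgue)"
  by (simp add: L2norm_def)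

lemma L2norm_cong_AE:
  assumes "f \<in> L2" "g \<in> L2" "AE x in lebesgue. f x = g x"
  shows "L2norm f = L2norm g"
proof -
  note [measurable] = L2_D(1)[OF assms(1)] L2_D(1)[OF assms(2)]
  show ?thesis
    unfolding L2norm_def using assms(3)
    by (intro arg_cong[of _ _ sqrt] integral_cong_AE) auto
qed

lemma L2norm_cmult: "L2norm (\<lambda>x. c * f x) = cmod c * L2norm f"
proof -
  have "(\<integral>x. (cmod (c * f x))\<^sup>2 \<partial>lebesgue) = (cmod c)\<^sup>2 * (\<integral>x. (cmod (f x))\<^sup>2 \<partial>lebesgue)"
    unfolding norm_mult power_mult_distrib by (rule integral_mult_right_zero)
  then show ?thesis unfolding L2norm_def by (simp only: real_sqrt_mult real_sqrt_abs abs_norm_cancel)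
qed

lemma L2norm_eq_0:
  assumes "f \<in> L2" "L2norm f = 0"
  shows "AE x in lebesgue. f x = 0"
proof -
  have "(\<integral>x. (cmod (f x))\<^sup>2 \<partial>lebesgue) = 0"
    using assms(2) by (metis L2norm_power2 zero_power2)
  then have "AE x in lebesgue. (cmod (f x))\<^sup>2 = 0"
    by (subst (asm) integral_nonneg_eq_0_iff_AE) (use L2_D(2)[OF assms(1)] in simp_all)
  then show ?thesis by simp
qed

lemma L2_Cauchy_Schwarz:
  assumes "f \<in> L2" "g \<in> L2"
  shows "(\<integral>x. cmod (f x) * cmod (g x) \<partial>lebesgue) \<le> L2norm f * L2norm g"
proof -
  have int: "integrable lebesgue (\<lambda>x. cmod (f x) * cmod (g x))"
    using integrable_norm[OF L2_integrable_mult[OF assms]] by (simp add: norm_mult)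
  \<comment> \<open>The arithmetic-geometric mean inequality with a free weight; t = L2norm g /
    L2norm f makes the right-hand side twice the product of the norms. A zero norm admits no such t
    and is treated through almost everywhere vanishing.\<close>
  have t: "2 * (\<integral>x. cmod (f x) * cmod (g x) \<partial>lebesgue) \<le> t * (L2norm f)\<^sup>2 + (L2norm g)\<^sup>2 / t" if "t > 0" for t
  proof -
    have "2 * (cmod (f x) * cmod (g x)) \<le> t * (cmod (f x))\<^sup>2 + (cmod (g x))\<^sup>2 / t" for x
      using sum_squares_bound[of "sqrt t * cmod (f x)" "cmod (g x) / sqrt t"] that
      by (simp add: power_mult_distrib power_divide)
    then have "(\<integral>x. 2 * (cmod (f x) * cmod (g x)) \<partial>lebesgue) \<le> (\<integral>x. t * (cmod (f x))\<^sup>2 + (cmod (g x))\<^sup>2 / t \<partial>lebesgue)"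
      by (rule integral_mono[rotated 2]) (simp_all add: int L2_D(2) assms)
    also have "\<dots> = t * (L2norm f)\<^sup>2 + (L2norm g)\<^sup>2 / t"
      by (simp add: L2norm_power2 L2_D(2)[OF assms(1)] L2_D(2)[OF assms(2)])
    finally show ?thesis by simp
  qed
  consider "L2norm f = 0" | "L2norm g = 0" | "L2norm f > 0" "L2norm g > 0"
    using L2norm_nonneg[of f] L2norm_nonneg[of g] by linarith
  then show ?thesis
  proof cases
    case 1
    have "(\<integral>x. cmod (f x) * cmod (g x) \<partial>lebesgue) = 0"
      using L2norm_eq_0[OF assms(1) 1] by (intro integral_eq_zero_AE) auto
    then show ?thesis by simp
  next
    case 2
    have "(\<integral>x. cmod (f x) * cmod (g x) \<partial>lebesgue) = 0"
      using L2norm_eq_0[OF assms(2) 2] by (intro integral_eq_zero_AE) auto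
    then show ?thesis by simp
  next
    case 3
    then show ?thesis
      using t[of "L2norm g / L2norm f"] by (simp add: power2_eq_square)
  qed
qed

lemma L2norm_triangle:
  assumes "f \<in> L2" "g \<in> L2"
  shows "L2norm (\<lambda>x. f x + g x) \<le> L2norm f + L2norm g"
proof (rule power2_le_imp_le)
  have int: "integrable lebesgue (\<lambda>x. cmod (f x) * cmod (g x))"
    using integrable_norm[OF L2_integrable_mult[OF assms]] by (simp add: norm_mult)
  have "(L2norm (\<lambda>x. f x + g x))\<^sup>2 \<le> (\<integral>x. (cmod (f x))\<^sup>2 + (cmod (g x))\<^sup>2 + 2 * (cmod (f x) * cmod (g x)) \<partial>lebesgue)"
    unfolding L2norm_power2
  proof (rule integral_mono)
    show "integrable lebesgue (\<lambda>x. (cmod (f x + g x))\<^sup>2)" using L2_add[OF assms] by (simp add: L2_def)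
    show "(cmod (f x + g x))\<^sup>2 \<le> (cmod (f x))\<^sup>2 + (cmod (g x))\<^sup>2 + 2 * (cmod (f x) * cmod (g x))" for x
      using power_mono[OF norm_triangle_ineq[of "f x" "g x"], of 2] by (simp add: power2_sum)
  qed (simp add: int L2_D(2) assms)
  also have "\<dots> = (L2norm f)\<^sup>2 + (L2norm g)\<^sup>2 + 2 * (\<integral>x. cmod (f x) * cmod (g x) \<partial>lebesgue)"
    by (simp add: L2norm_power2 int L2_D(2)[OF assms(1)] L2_D(2)[OF assms(2)])
  also have "\<dots> \<le> (L2norm f + L2norm g)\<^sup>2"
    using L2_Cauchy_Schwarz[OF assms] by (simp add: power2_sum)
  finally show "(L2norm (\<lambda>x. f x + g x))\<^sup>2 \<le> (L2norm f + L2norm g)\<^sup>2" .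
qed simp

lemma L2norm_triangle_diff:
  assumes "f \<in> L2" "g \<in> L2"
  shows "\<bar>L2norm f - L2norm g\<bar> \<le> L2norm (\<lambda>x. f x - g x)"
proof -
  have "L2norm f \<le> L2norm (\<lambda>x. f x - g x) + L2norm g"
    using L2norm_triangle[OF L2_diff[OF assms] assms(2)] by simp
  moreover have "L2norm g \<le> L2norm (\<lambda>x. g x - f x) + L2norm f"
    using L2norm_triangle[OF L2_diff[OF assms(2,1)] assms(1)] by simp
  moreover have "L2norm (\<lambda>x. g x - f x) = L2norm (\<lambda>x. f x - g x)"
    by (simp add: L2norm_def norm_minus_commute)
  ultimately show ?thesis by linarith
qed

section \<open>Coherent states\<close>

lemma borel_measurable_lebesgue_continuous:
  fixes f :: "'a::euclidean_space \<Rightarrow> 'b::topological_space"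
  shows "continuous_on UNIV f \<Longrightarrow> f \<in> borel_measurable lebesgue"
  by (intro measurable_completion) (simp add: borel_measurable_continuous_onI)

section \<open>Gaussians against polynomials and exponentials of the norm\<close>

lemma gaussian_integrable:
  assumes "\<kappa> > 0"
  shows "integrable lebesgue (\<lambda>x::'a::euclidean_space. exp (- \<kappa> * (norm x)\<^sup>2))"
proof -
  define \<sigma> where "\<sigma> = 1 / sqrt (2 * \<kappa>)"
  have \<sigma>: "\<sigma> > 0" "\<sigma>\<^sup>2 = 1 / (2 * \<kappa>)" using assms by (simp_all add: \<sigma>_def power_divide)
  have "integrable lborel (\<lambda>t. sqrt (2 * pi * \<sigma>\<^sup>2) * normal_density 0 \<sigma> t)"
    using integrable_normal_density[OF \<sigma>(1)] by (rule integrable_mult_right)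
  moreover have "sqrt (2 * pi * \<sigma>\<^sup>2) * normal_density 0 \<sigma> t = exp (- \<kappa> * t\<^sup>2)" for t
    using \<sigma> assms by (simp add: normal_density_def)
  ultimately have one: "integrable lborel (\<lambda>t::real. exp (- \<kappa> * t\<^sup>2))" by simp
  have split: "exp (- \<kappa> * (norm x)\<^sup>2) = (\<Prod>b\<in>Basis. exp (- \<kappa> * (x \<bullet> b)\<^sup>2))" for x :: 'a
    unfolding exp_sum[OF finite_Basis, symmetric] sum_distrib_left[symmetric] power2_norm_eq_inner
    by (subst euclidean_inner) (simp only: power2_eq_square)
  have "(\<integral>\<^sup>+(x::'a). exp (- \<kappa> * (norm x)\<^sup>2) \<partial>lborel) = (\<integral>\<^sup>+(x::'a). (\<Prod>b\<in>Basis. ennreal (exp (- \<kappa> * (x \<bullet> b)\<^sup>2))) \<partial>lborel)"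
    unfolding split by (simp add: prod_ennreal)
  also have "\<dots> = (\<Prod>b\<in>(Basis::'a set). (\<integral>\<^sup>+t. ennreal (exp (- \<kappa> * t\<^sup>2)) \<partial>lborel))"
    by (intro nn_integral_lborel_prod) auto
  also have "\<dots> < \<infinity>"
    using one by (simp add: nn_integral_eq_integral prod_ennreal less_top[symmetric] power_eq_top_ennreal)
  finally have "integrable lborel (\<lambda>x::'a. exp (- \<kappa> * (norm x)\<^sup>2))"
    by (intro integrableI_nonneg) auto
  then show ?thesis by (subst integrable_completion) auto
qed

text \<open>Since 1 + r \<le> exp r, the polynomial factor merely adds k to C. Completing the square
  spends half of \<kappa> on the linear term and keeps the other half for integrability.\<close>

lemma poly_exp_le_gaussian:
  fixes r C \<kappa> :: real
  assumes "\<kappa> > 0" "r \<ge> 0"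
  shows "(1 + r) ^ k * exp (C * r - \<kappa> * r\<^sup>2) \<le> exp ((real k + C)\<^sup>2 / (2 * \<kappa>)) * exp (- (\<kappa> / 2) * r\<^sup>2)"
proof -
  have "(1 + r) ^ k \<le> exp r ^ k" using assms by (intro power_mono) auto
  then have "(1 + r) ^ k * exp (C * r - \<kappa> * r\<^sup>2) \<le> exp (k * r) * exp (C * r - \<kappa> * r\<^sup>2)"
    by (intro mult_right_mono) (auto simp: exp_of_nat_mult)
  also have "\<dots> = exp ((k + C) * r - \<kappa> * r\<^sup>2)" by (simp add: algebra_simps flip: exp_add)
  also have "\<dots> \<le> exp ((real k + C)\<^sup>2 / (2 * \<kappa>) + - (\<kappa> / 2) * r\<^sup>2)"
  proof -
    have "0 \<le> ((k + C) - \<kappa> * r)\<^sup>2 / (2 * \<kappa>)" using assms by simp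
    also have "\<dots> = (k + C)\<^sup>2 / (2 * \<kappa>) - (k + C) * r + \<kappa> / 2 * r\<^sup>2"
      using assms by (simp add: field_simps power2_eq_square)
    finally show ?thesis by simp
  qed
  finally show ?thesis by (simp only: exp_add)
qed

lemma poly_exp_gaussian_integrable:
  fixes C :: real
  assumes "\<kappa> > 0"
  shows "integrable lebesgue (\<lambda>x::'a::euclidean_space. (1 + norm x) ^ k * exp (C * norm x - \<kappa> * (norm x)\<^sup>2))"
proof (rule integrable_by_bound)
  show "integrable lebesgue (\<lambda>x::'a. exp ((real k + C)\<^sup>2 / (2 * \<kappa>)) * exp (- (\<kappa> / 2) * (norm x)\<^sup>2))"
    using gaussian_integrable[of "\<kappa> / 2"] assms by (intro integrable_mult_right) auto
  show "norm ((1 + norm x) ^ k * exp (C * norm x - \<kappa> * (norm x)\<^sup>2)) \<le> exp ((real k + C)\<^sup>2 / (2 * \<kappa>)) * exp (- (\<kappa> / 2) * (norm x)\<^sup>2)" for x :: 'a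
    using poly_exp_le_gaussian[OF assms, of "norm x" k C] by simp
qed (intro borel_measurable_lebesgue_continuous continuous_intros)

text \<open>\<open>Schwartz\<close> quantifies over all iterated partial derivatives, so the
  induction needs a class closed under differentiation. Polynomial multiples of a fixed coherent
  state form one.\<close>

inductive poly_fun :: "('a::euclidean_space \<Rightarrow> complex) \<Rightarrow> bool" where
  poly_const: "poly_fun (\<lambda>x. c)"
| poly_coord: "poly_fun (\<lambda>x. of_real (x \<bullet> i))"
| poly_add: "poly_fun p \<Longrightarrow> poly_fun q \<Longrightarrow> poly_fun (\<lambda>x. p x + q x)"
| poly_mult: "poly_fun p \<Longrightarrow> poly_fun q \<Longrightarrow> poly_fun (\<lambda>x. p x * q x)"

lemma poly_fun_derivative:
  assumes "poly_fun p"
  shows "\<exists>D. (\<forall>x. (p has_derivative D x) (at x)) \<and> (\<forall>i. poly_fun (\<lambda>x. D x i))"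
  using assms
proof induction
  case (poly_const c)
  show ?case by (rule exI[of _ "\<lambda>x i. 0"]) (auto intro: poly_fun.intros)
next
  case (poly_coord i)
  show ?case
    by (rule exI[of _ "\<lambda>x h. of_real (h \<bullet> i)"]) (auto intro!: poly_fun.intros derivative_eq_intros)
next
  case (poly_add p q)
  then obtain D D' where D: "\<And>x. (p has_derivative D x) (at x)" "\<And>i. poly_fun (\<lambda>x. D x i)"
    "\<And>x. (q has_derivative D' x) (at x)" "\<And>i. poly_fun (\<lambda>x. D' x i)" by auto
  then show ?case
    by (intro exI[of _ "\<lambda>x h. D x h + D' x h"]) (auto intro!: poly_fun.poly_add has_derivative_add)
next
  case (poly_mult p q)
  then obtain D D' where D: "\<And>x. (p has_derivative D x) (at x)" "\<And>i. poly_fun (\<lambda>x. D x i)"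
    "\<And>x. (q has_derivative D' x) (at x)" "\<And>i. poly_fun (\<lambda>x. D' x i)" by auto
  then show ?case using poly_mult.hyps
    by (intro exI[of _ "\<lambda>x h. p x * D' x h + D x h * q x"]) (auto intro!: poly_fun.poly_add poly_fun.poly_mult has_derivative_mult)
qed

lemma poly_fun_growth:
  assumes "poly_fun p"
  shows "\<exists>C k. C \<ge> 0 \<and> (\<forall>x. cmod (p x) \<le> C * (1 + norm x) ^ k)"
  using assms
proof induction
  case (poly_const c)
  show ?case by (rule exI[of _ "cmod c"], rule exI[of _ 0]) auto
next
  case (poly_coord i)
  have "cmod (of_real (x \<bullet> i)) \<le> norm i * (1 + norm x) ^ 1" for x
    using Cauchy_Schwarz_ineq2[of x i] by (simp add: algebra_simps) (smt (verit) norm_ge_zero)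
  then show ?case by (intro exI[of _ "norm i"] exI[of _ 1]) auto
next
  case (poly_add p q)
  then obtain C k C' k' where B: "C \<ge> 0" "C' \<ge> 0" "\<And>x. cmod (p x) \<le> C * (1 + norm x) ^ k"
     "\<And>x. cmod (q x) \<le> C' * (1 + norm x) ^ k'" by auto
  have "cmod (p x + q x) \<le> (C + C') * (1 + norm x) ^ (k + k')" for x
  proof -
    have "C * (1 + norm x) ^ k \<le> C * (1 + norm x) ^ (k + k')" "C' * (1 + norm x) ^ k' \<le> C' * (1 + norm x) ^ (k + k')"
      using B by (auto intro!: mult_left_mono power_increasing)
    then show ?thesis using B(3,4)[of x] norm_triangle_ineq[of "p x" "q x"] by (simp add: algebra_simps)
  qed
  then show ?case using B by (intro exI[of _ "C + C'"] exI[of _ "k + k'"]) auto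
next
  case (poly_mult p q)
  then obtain C k C' k' where B: "C \<ge> 0" "C' \<ge> 0" "\<And>x. cmod (p x) \<le> C * (1 + norm x) ^ k"
     "\<And>x. cmod (q x) \<le> C' * (1 + norm x) ^ k'" by auto
  have "cmod (p x * q x) \<le> (C * C') * (1 + norm x) ^ (k + k')" for x
    using mult_mono[OF B(3)[of x] B(4)[of x]] B(1) by (simp add: norm_mult power_add mult_ac)
  then show ?case using B by (intro exI[of _ "C * C'"] exI[of _ "k + k'"]) auto
qed

text \<open>The ground state of the oscillator displaced in phase space: Re \<zeta> moves the centre
  to 2 (Re \<zeta>) \<omega>, and Im \<zeta> is a frequency in the direction \<omega>. Leaving it
  unnormalised keeps it holomorphic in \<zeta>.\<close>

definition coherent :: "'a::euclidean_space \<Rightarrow> complex \<Rightarrow> 'a \<Rightarrow> complex" where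
  "coherent \<omega> \<zeta> x = exp (\<zeta> * of_real (x \<bullet> \<omega>) - of_real ((norm x)\<^sup>2 / 4))"

lemma cmod_coherent: "cmod (coherent \<omega> \<zeta> x) = exp (Re \<zeta> * (x \<bullet> \<omega>) - (norm x)\<^sup>2 / 4)"
  by (simp add: coherent_def)

lemma cmod_coherent_le: "cmod (coherent \<omega> \<zeta> x) \<le> exp (cmod \<zeta> * norm \<omega> * norm x - (norm x)\<^sup>2 / 4)"
proof -
  have "Re \<zeta> * (x \<bullet> \<omega>) \<le> \<bar>Re \<zeta>\<bar> * \<bar>x \<bullet> \<omega>\<bar>" by (simp add: abs_mult[symmetric])
  also have "\<dots> \<le> cmod \<zeta> * (norm x * norm \<omega>)"
    by (intro mult_mono abs_Re_le_cmod Cauchy_Schwarz_ineq2) auto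
  finally show ?thesis by (simp add: cmod_coherent mult_ac)
qed

lemma coherent_has_derivative:
  "(coherent \<omega> \<zeta> has_derivative (\<lambda>h. (\<zeta> * of_real (h \<bullet> \<omega>) - of_real (x \<bullet> h) / 2) * coherent \<omega> \<zeta> x)) (at x)"
proof -
  have "((\<lambda>x. \<zeta> * of_real (x \<bullet> \<omega>) - of_real ((x \<bullet> x) / 4)) has_derivative
      (\<lambda>h. \<zeta> * of_real (h \<bullet> \<omega>) - of_real (x \<bullet> h) / 2)) (at x)"
    by (rule derivative_eq_intros refl | simp)+ (simp add: fun_eq_iff inner_commute)
  from has_derivative_compose[OF this DERIV_exp[unfolded has_field_derivative_def]] show ?thesis
    unfolding coherent_def[abs_def] power2_norm_eq_inner by (simp add: mult.commute)
qed

lemma poly_coherent_has_derivative: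
  assumes "poly_fun p"
  shows "\<exists>q. (\<forall>x. ((\<lambda>x. p x * coherent \<omega> \<zeta> x) has_derivative (\<lambda>h. q h x * coherent \<omega> \<zeta> x)) (at x)) \<and> (\<forall>i. poly_fun (q i))"
proof -
  obtain D where D: "\<And>x. (p has_derivative D x) (at x)" "\<And>i. poly_fun (\<lambda>x. D x i)"
    using poly_fun_derivative[OF assms] by auto
  define q where "q = (\<lambda>h x. p x * (\<zeta> * of_real (h \<bullet> \<omega>) + (-1/2) * of_real (x \<bullet> h)) + D x h)"
  have "poly_fun (q i)" for i unfolding q_def
    by (intro poly_fun.intros assms D)
  moreover have "((\<lambda>x. p x * coherent \<omega> \<zeta> x) has_derivative (\<lambda>h. q h x * coherent \<omega> \<zeta> x)) (at x)" for x
    by (rule has_derivative_eq_rhs[OF has_derivative_mult[OF D(1) coherent_has_derivative]])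
       (simp add: q_def fun_eq_iff algebra_simps)
  ultimately show ?thesis by blast
qed

lemma poly_coherent_L2:
  assumes "poly_fun p"
  shows "(\<lambda>x. p x * coherent \<omega> \<zeta> x) \<in> L2"
proof -
  obtain q where q: "\<And>x. ((\<lambda>x. p x * coherent \<omega> \<zeta> x) has_derivative (\<lambda>h. q h x * coherent \<omega> \<zeta> x)) (at x)"
    using poly_coherent_has_derivative[OF assms] by blast
  have "continuous_on UNIV (\<lambda>x. p x * coherent \<omega> \<zeta> x)"
    using q has_derivative_continuous by (intro continuous_at_imp_continuous_on) blast
  then have meas: "(\<lambda>x. p x * coherent \<omega> \<zeta> x) \<in> borel_measurable lebesgue"
    by (rule borel_measurable_lebesgue_continuous)
  obtain C k where B: "C \<ge> 0" "\<And>x. cmod (p x) \<le> C * (1 + norm x) ^ k"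
    using poly_fun_growth[OF assms] by blast
  have "integrable lebesgue (\<lambda>x. (cmod (p x * coherent \<omega> \<zeta> x))\<^sup>2)"
  proof (rule integrable_by_bound)
    show "integrable lebesgue (\<lambda>x::'a. C\<^sup>2 * ((1 + norm x) ^ (2 * k) * exp (2 * cmod \<zeta> * norm \<omega> * norm x - 1/2 * (norm x)\<^sup>2)))"
      by (intro integrable_mult_right poly_exp_gaussian_integrable) auto
    fix x
    have "(cmod (p x * coherent \<omega> \<zeta> x))\<^sup>2 \<le> (C * (1 + norm x) ^ k * exp (cmod \<zeta> * norm \<omega> * norm x - (norm x)\<^sup>2 / 4))\<^sup>2"
      unfolding norm_mult using B(1) by (intro power_mono mult_mono B cmod_coherent_le) auto
    also have "\<dots> = C\<^sup>2 * ((1 + norm x) ^ (2 * k) * exp (2 * cmod \<zeta> * norm \<omega> * norm x - 1/2 * (norm x)\<^sup>2))"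
    proof -
      have "exp (2 * cmod \<zeta> * norm \<omega> * norm x - 1/2 * (norm x)\<^sup>2) = (exp (cmod \<zeta> * norm \<omega> * norm x - (norm x)\<^sup>2 / 4))\<^sup>2"
        unfolding exp_double[symmetric] by (simp add: algebra_simps)
      then show ?thesis by (simp only: power_even_eq power_mult_distrib mult.assoc)
    qed
    finally show "norm ((cmod (p x * coherent \<omega> \<zeta> x))\<^sup>2) \<le> C\<^sup>2 * ((1 + norm x) ^ (2 * k) * exp (2 * cmod \<zeta> * norm \<omega> * norm x - 1/2 * (norm x)\<^sup>2))"
      by simp
  qed (use meas in measurable)
  then show ?thesis using meas by (simp add: L2_def)
qed

lemma coherent_L2: "coherent \<omega> \<zeta> \<in> L2"
  using poly_coherent_L2[OF poly_const[of 1], of \<omega> \<zeta>] by simp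

lemma poly_coherent_Schwartz:
  assumes "poly_fun p"
  shows "(\<lambda>x. p x * coherent \<omega> \<zeta> x) \<in> Schwartz"
proof -
  have iter: "\<exists>q. poly_fun q \<and> foldr partial is (\<lambda>x. p x * coherent \<omega> \<zeta> x) = (\<lambda>x. q x * coherent \<omega> \<zeta> x)" for "is"
  proof (induction "is")
    case (Cons i "is")
    then obtain q where q: "poly_fun q" "foldr partial is (\<lambda>x. p x * coherent \<omega> \<zeta> x) = (\<lambda>x. q x * coherent \<omega> \<zeta> x)" by blast
    obtain r where r: "\<And>x. ((\<lambda>x. q x * coherent \<omega> \<zeta> x) has_derivative (\<lambda>h. r h x * coherent \<omega> \<zeta> x)) (at x)" "\<And>i. poly_fun (r i)"
      using poly_coherent_has_derivative[OF q(1)] by blast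
    have "partial i (\<lambda>x. q x * coherent \<omega> \<zeta> x) = (\<lambda>x. r i x * coherent \<omega> \<zeta> x)"
      unfolding partial_def[abs_def] by (simp add: frechet_derivative_at[OF r(1), symmetric])
    then show ?case using q r(2) by auto
  qed (use assms in auto)
  have "\<exists>C. \<forall>x. norm x ^ n * cmod (q x * coherent \<omega> \<zeta> x) \<le> C" if q: "poly_fun q" for n q
  proof -
    obtain C k where B: "C \<ge> 0" "\<And>x. cmod (q x) \<le> C * (1 + norm x) ^ k"
      using poly_fun_growth[OF q] by blast
    have "norm x ^ n * cmod (q x * coherent \<omega> \<zeta> x) \<le> C * exp ((real (n + k) + cmod \<zeta> * norm \<omega>)\<^sup>2 / (2 * (1/4)))" for x
    proof -
      have "norm x ^ n * cmod (q x * coherent \<omega> \<zeta> x) \<le> (1 + norm x) ^ n * (C * (1 + norm x) ^ k * exp (cmod \<zeta> * norm \<omega> * norm x - (norm x)\<^sup>2 / 4))"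
        unfolding norm_mult using B(1) by (intro mult_mono power_mono B cmod_coherent_le) auto
      also have "\<dots> = C * ((1 + norm x) ^ (n + k) * exp (cmod \<zeta> * norm \<omega> * norm x - 1/4 * (norm x)\<^sup>2))"
        by (simp add: power_add)
      also have "\<dots> \<le> C * (exp ((real (n + k) + cmod \<zeta> * norm \<omega>)\<^sup>2 / (2 * (1/4))) * exp (- (1/4/2) * (norm x)\<^sup>2))"
        using B(1) by (intro mult_left_mono poly_exp_le_gaussian) auto
      also have "\<dots> \<le> C * (exp ((real (n + k) + cmod \<zeta> * norm \<omega>)\<^sup>2 / (2 * (1/4))) * 1)"
        using B(1) by (intro mult_left_mono) auto
      finally show ?thesis by simp
    qed
    then show ?thesis by blast
  qed
  moreover have "(\<lambda>x. q x * coherent \<omega> \<zeta> x) differentiable (at x)" if "poly_fun q" for q x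
    using poly_coherent_has_derivative[OF that] unfolding differentiable_def by blast
  ultimately show ?thesis
    unfolding Schwartz_def mem_Collect_eq using iter by metis
qed

section \<open>The unitary group on coherent states\<close>

lemma unitary_opD:
  assumes "unitary_op T"
  shows "f \<in> L2 \<Longrightarrow> T f \<in> L2"
    and "f \<in> L2 \<Longrightarrow> g \<in> L2 \<Longrightarrow> AE x in lebesgue. T (\<lambda>y. c * f y + d * g y) x = c * T f x + d * T g x"
    and "f \<in> L2 \<Longrightarrow> L2norm (T f) = L2norm f"
  using assms unfolding unitary_op_def by blast+

lemma L2norm_add_cmult_power2:
  assumes "f \<in> L2" "g \<in> L2"
  shows "(L2norm (\<lambda>x. f x + c * g x))\<^sup>2 =
    (L2norm f)\<^sup>2 + (cmod c)\<^sup>2 * (L2norm g)\<^sup>2 + 2 * Re (cnj c * (\<integral>x. f x * cnj (g x) \<partial>lebesgue))"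
proof -
  have int: "integrable lebesgue (\<lambda>x. f x * cnj (g x))"
    by (intro L2_integrable_mult L2_cnj assms)
  have eq: "(cmod (f x + c * g x))\<^sup>2 = (cmod (f x))\<^sup>2 + (cmod c)\<^sup>2 * (cmod (g x))\<^sup>2 + 2 * Re (cnj c * (f x * cnj (g x)))" for x
    by (simp only: cmod_power2) (simp add: power2_eq_square algebra_simps)
  have "(\<integral>x. Re (cnj c * (f x * cnj (g x))) \<partial>lebesgue) = Re (\<integral>x. cnj c * (f x * cnj (g x)) \<partial>lebesgue)"
    by (intro integral_Re integrable_mult_right int)
  then have re: "(\<integral>x. Re (cnj c * (f x * cnj (g x))) \<partial>lebesgue) = Re (cnj c * (\<integral>x. f x * cnj (g x) \<partial>lebesgue))"
    by (simp only: integral_mult_right_zero)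
  have intre: "integrable lebesgue (\<lambda>x. Re (cnj c * (f x * cnj (g x))))"
    by (intro integrable_Re integrable_mult_right int)
  show ?thesis
    unfolding L2norm_power2 eq re[symmetric]
    by (simp add: L2_D(2)[OF assms(1)] L2_D(2)[OF assms(2)] intre del: times_complex.sel)
qed

text \<open>Polarization: \<open>unitary_op\<close> speaks of norms only, and expanding the norm of
  f + c g for c = 1 and c = \<i> recovers the real and imaginary parts of the inner product.
  Linearity holds only almost everywhere, so it is applied inside the norm.\<close>

lemma unitary_op_inner:
  assumes T: "unitary_op T" and "f \<in> L2" "g \<in> L2"
  shows "(\<integral>x. T f x * cnj (T g x) \<partial>lebesgue) = (\<integral>x. f x * cnj (g x) \<partial>lebesgue)"
proof -
  note T = unitary_opD[OF T]
  have "L2norm (\<lambda>x. T f x + c * T g x) = L2norm (\<lambda>x. f x + c * g x)" for c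
  proof -
    have "L2norm (T (\<lambda>x. 1 * f x + c * g x)) = L2norm (\<lambda>x. 1 * f x + c * g x)"
      by (intro T L2_add L2_cmult assms)
    moreover have "L2norm (T (\<lambda>x. 1 * f x + c * g x)) = L2norm (\<lambda>x. 1 * T f x + c * T g x)"
      by (intro L2norm_cong_AE T L2_add L2_cmult assms)
    ultimately show ?thesis by simp
  qed
  then have "Re (cnj c * (\<integral>x. T f x * cnj (T g x) \<partial>lebesgue)) = Re (cnj c * (\<integral>x. f x * cnj (g x) \<partial>lebesgue))" for c
    using L2norm_add_cmult_power2[of "T f" "T g" c] L2norm_add_cmult_power2[OF assms(2,3), of c] T assms by simp
  from this[of 1] this[of \<i>] show ?thesis by (simp add: complex_eq_iff)
qed

text \<open>Uniqueness for the Cauchy problem: the L2 distance between U t (W 0) and W t is a real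
  function with derivative 0 that starts at 0. Differentiability is needed only for h \<mapsto> U h
  (W t) at h = 0, and this is what membership in the generator provides.\<close>

lemma unitary_group_flow:
  fixes W G :: "real \<Rightarrow> 'a::euclidean_space \<Rightarrow> complex"
  assumes U: "unitary_group U"
    and gen: "\<And>t. (W t, G t) \<in> generator U"
    and diff: "\<And>t. ((\<lambda>h. L2norm (\<lambda>x. (W (t + h) x - W t x) / of_real h - G t x)) \<longlongrightarrow> 0) (at 0)"
  shows "AE x in lebesgue. U t (W 0) x = W t x"
proof -
  have un: "unitary_op (U t)" for t using U by (simp add: unitary_group_def)
  note UD = unitary_opD[OF un]
  have W[intro, simp]: "W t \<in> L2" "G t \<in> L2" for t using gen[of t] by (auto simp: generator_def)
  have UL[intro, simp]: "U t f \<in> L2" if "f \<in> L2" for t f using UD that by blast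
  define D where "D = (\<lambda>t. L2norm (\<lambda>x. U t (W 0) x - W t x))"
  \<comment> \<open>The isometry U h carries the difference at time t to time t + h without changing
    its norm; the reverse triangle inequality then leaves only the error of \<open>W\<close> as an
    orbit over a time step h.\<close>
  have step: "\<bar>D (t + h) - D t\<bar> \<le> L2norm (\<lambda>x. U h (W t) x - W (t + h) x)" for t h
  proof -
    have ae: "AE x in lebesgue. U h (\<lambda>y. 1 * U t (W 0) y + (-1) * W t y) x = 1 * U h (U t (W 0)) x + (-1) * U h (W t) x"
      by (intro UD UL W)
    have ae2: "AE x in lebesgue. U (h + t) (W 0) x = U h (U t (W 0)) x"
      using U W unfolding unitary_group_def by blast
    have "D t = L2norm (U h (\<lambda>y. 1 * U t (W 0) y + (-1) * W t y))"
      by (subst UD(3)) (auto simp: D_def intro!: L2_diff)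
    also have "\<dots> = L2norm (\<lambda>x. U h (U t (W 0)) x - U h (W t) x)"
      by (rule L2norm_cong_AE) (use ae in \<open>auto intro!: UL L2_diff\<close>)
    finally have "\<bar>D (t + h) - D t\<bar> = \<bar>L2norm (\<lambda>x. U (t + h) (W 0) x - W (t + h) x) - L2norm (\<lambda>x. U h (U t (W 0)) x - U h (W t) x)\<bar>"
      by (simp add: D_def)
    also have "\<dots> \<le> L2norm (\<lambda>x. (U (t + h) (W 0) x - W (t + h) x) - (U h (U t (W 0)) x - U h (W t) x))"
      by (intro L2norm_triangle_diff L2_diff UL W)
    also have "\<dots> = L2norm (\<lambda>x. U h (W t) x - W (t + h) x)"
      by (rule L2norm_cong_AE) (use ae2 in \<open>auto intro!: UL L2_diff simp: add.commute\<close>)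
    finally show ?thesis .
  qed
  have "(D has_real_derivative 0) (at t)" for t
  proof -
    have "((\<lambda>h. (D (t + h) - D t) / h) \<longlongrightarrow> 0) (at 0)"
    proof (rule Lim_null_comparison)
      show "((\<lambda>h. L2norm (\<lambda>x. (U h (W t) x - W t x) / of_real h - G t x) + L2norm (\<lambda>x. (W (t + h) x - W t x) / of_real h - G t x)) \<longlongrightarrow> 0) (at 0)"
        using tendsto_add[OF _ diff[of t]] gen[of t] by (simp add: generator_def)
      have "norm ((D (t + h) - D t) / h) \<le> L2norm (\<lambda>x. (U h (W t) x - W t x) / of_real h - G t x) + L2norm (\<lambda>x. (W (t + h) x - W t x) / of_real h - G t x)"
        if h: "h \<noteq> 0" for h
      proof -
        have q: "(\<lambda>x. (f x - g x) / of_real h - k x) \<in> L2" if "f \<in> L2" "g \<in> L2" "k \<in> L2" for f g k :: "'a \<Rightarrow> complex"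
          using L2_diff[OF L2_cmult[OF L2_diff[OF that(1,2)], of "1 / of_real h"] that(3)] by simp
        have "norm ((D (t + h) - D t) / h) \<le> L2norm (\<lambda>x. U h (W t) x - W (t + h) x) / \<bar>h\<bar>"
          using step[of t h] by (simp add: divide_right_mono)
        also have "\<dots> = L2norm (\<lambda>x. (1 / of_real h) * (U h (W t) x - W (t + h) x))"
          by (subst L2norm_cmult) (simp add: norm_divide)
        \<comment> \<open>Inserting W t and G t turns the error divided by h into a difference of
          two errors of difference quotients, both of which tend to 0.\<close>
        also have "(\<lambda>x. (1 / of_real h) * (U h (W t) x - W (t + h) x)) =
            (\<lambda>x. ((U h (W t) x - W t x) / of_real h - G t x) + (-1) * ((W (t + h) x - W t x) / of_real h - G t x))"
          using h by (auto simp: field_simps)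
        also have "L2norm \<dots> \<le> L2norm (\<lambda>x. (U h (W t) x - W t x) / of_real h - G t x) + L2norm (\<lambda>x. (-1) * ((W (t + h) x - W t x) / of_real h - G t x))"
          by (intro L2norm_triangle L2_cmult q UL W)
        finally show ?thesis unfolding L2norm_cmult by simp
      qed
      then show "\<forall>\<^sub>F h in at 0. norm ((D (t + h) - D t) / h) \<le> L2norm (\<lambda>x. (U h (W t) x - W t x) / of_real h - G t x) + L2norm (\<lambda>x. (W (t + h) x - W t x) / of_real h - G t x)"
        by (simp add: eventually_at_filter)
    qed
    then show ?thesis by (simp add: DERIV_def)
  qed
  then have "D t = D 0"
    using DERIV_isconst_all by blast
  also have "D 0 = 0"
  proof -
    have "D 0 = L2norm (\<lambda>x::'a. 0 * W 0 x)"
      unfolding D_def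
    proof (rule L2norm_cong_AE)
      show "AE x in lebesgue. U 0 (W 0) x - W 0 x = 0 * W 0 x"
        using U W unfolding unitary_group_def by simp
    qed (intro L2_diff L2_cmult UL W)+
    then show ?thesis unfolding L2norm_cmult by simp
  qed
  finally have "L2norm (\<lambda>x. U t (W 0) x - W t x) = 0" by (simp add: D_def)
  from L2norm_eq_0[OF _ this] show ?thesis by (auto intro!: L2_diff)
qed

text \<open>Dominated convergence upgrades the pointwise derivative to one in L2. The mean value
  inequality bounds the quotient by \<open>M\<close>, hence its error by 2 M and the square by 4
  M^2; for this \<open>M\<close> must dominate \<open>G\<close> at all times simultaneously.\<close>

lemma L2_difference_quotient:
  fixes W G :: "real \<Rightarrow> 'a::euclidean_space \<Rightarrow> complex" and M :: "'a \<Rightarrow> real"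
  assumes deriv: "\<And>t x. ((\<lambda>t. W t x) has_vector_derivative G t x) (at t)"
    and bd: "\<And>t x. cmod (G t x) \<le> M x"
    and M: "integrable lebesgue (\<lambda>x. (M x)\<^sup>2)"
    and meas[measurable]: "\<And>t. W t \<in> borel_measurable lebesgue" "\<And>t. G t \<in> borel_measurable lebesgue"
  shows "((\<lambda>h. L2norm (\<lambda>x. (W (t + h) x - W t x) / of_real h - G t x)) \<longlongrightarrow> 0) (at 0)"
  unfolding tendsto_at_iff_sequentially o_def
proof (intro allI impI)
  fix X :: "nat \<Rightarrow> real" assume X: "\<forall>n. X n \<in> UNIV - {0}" "X \<longlonglongrightarrow> 0"
  let ?q = "\<lambda>n x. (W (t + X n) x - W t x) / of_real (X n) - G t x"
  have M0: "M x \<ge> 0" for x using order_trans[OF norm_ge_zero bd] .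
  have "(\<lambda>n. \<integral>x. (cmod (?q n x))\<^sup>2 \<partial>lebesgue) \<longlonglongrightarrow> (\<integral>x. 0 \<partial>(lebesgue :: 'a measure))"
  proof (rule integral_dominated_convergence)
    show "integrable lebesgue (\<lambda>x. 4 * (M x)\<^sup>2)" using M by simp
    show "AE x in lebesgue. (\<lambda>n. (cmod (?q n x))\<^sup>2) \<longlonglongrightarrow> 0"
    proof (intro AE_I2)
      fix x
      have "((\<lambda>h. norm (W (t + h) x - W t x - h *\<^sub>R G t x) / norm h) \<longlongrightarrow> 0) (at 0)"
        using deriv[of x t] unfolding has_vector_derivative_def has_derivative_at by blast
      then have "(\<lambda>n. norm (W (t + X n) x - W t x - X n *\<^sub>R G t x) / norm (X n)) \<longlonglongrightarrow> 0"
        using X unfolding tendsto_at_iff_sequentially o_def by blast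
      moreover have "norm (W (t + X n) x - W t x - X n *\<^sub>R G t x) / norm (X n) = cmod (?q n x)" for n
      proof -
        have "?q n x = (W (t + X n) x - W t x - X n *\<^sub>R G t x) / of_real (X n)"
          using X(1) by (simp add: scaleR_conv_of_real diff_divide_distrib)
        then show ?thesis by (simp add: norm_divide)
      qed
      ultimately have "(\<lambda>n. cmod (?q n x)) \<longlonglongrightarrow> 0" by simp
      then show "(\<lambda>n. (cmod (?q n x))\<^sup>2) \<longlonglongrightarrow> 0"
        using tendsto_power[of _ 0 sequentially 2] by fastforce
    qed
    show "AE x in lebesgue. norm ((cmod (?q n x))\<^sup>2) \<le> 4 * (M x)\<^sup>2" for n
    proof (intro AE_I2)
      fix x
      have "cmod (W (t + X n) x - W t x) \<le> M x * norm ((t + X n) - t)"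
        using deriv bd unfolding has_vector_derivative_def
        by (intro differentiable_bound[of UNIV "\<lambda>t. W t x" "\<lambda>t h. h *\<^sub>R G t x"])
           (auto intro!: onorm_le simp: mult.commute mult_left_mono)
      then have "cmod ((W (t + X n) x - W t x) / of_real (X n)) \<le> M x"
        using X(1) by (simp add: norm_divide divide_le_eq)
      then have "cmod (?q n x) \<le> 2 * M x"
        using norm_triangle_ineq4[of "(W (t + X n) x - W t x) / of_real (X n)" "G t x"] bd[of t x] by linarith
      from power_mono[OF this norm_ge_zero, of 2]
      show "norm ((cmod (?q n x))\<^sup>2) \<le> 4 * (M x)\<^sup>2" by (simp add: power_mult_distrib)
    qed
  qed measurable
  then have "(\<lambda>n. sqrt (\<integral>x. (cmod (?q n x))\<^sup>2 \<partial>lebesgue)) \<longlonglongrightarrow> sqrt 0"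
    by (intro tendsto_real_sqrt) simp
  then show "(\<lambda>n. L2norm (?q n)) \<longlonglongrightarrow> 0" by (simp add: L2norm_def)
qed

section \<open>Coherent states in the domain of the oscillator and their orbits\<close>

lemma laplacian_coherent:
  fixes \<omega> :: "'a::euclidean_space"
  assumes "norm \<omega> = 1"
  shows "laplacian (\<lambda>x. k * coherent \<omega> \<eta> x) x =
    (of_real ((norm x)\<^sup>2 / 4) - of_real DIM('a) / 2 - \<eta> * of_real (x \<bullet> \<omega>) + \<eta>\<^sup>2) * (k * coherent \<omega> \<eta> x)"
proof -
  define p where "p = (\<lambda>i x. \<eta> * of_real (i \<bullet> \<omega>) - of_real (x \<bullet> i) / 2 :: complex)"
  have d1: "((\<lambda>x. k * coherent \<omega> \<eta> x) has_derivative (\<lambda>h. k * (p h x * coherent \<omega> \<eta> x))) (at x)" for x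
    using has_derivative_mult_right[OF coherent_has_derivative[of \<omega> \<eta> x], of k] by (simp add: p_def)
  have "partial i (\<lambda>x. k * coherent \<omega> \<eta> x) = (\<lambda>x. k * (p i x * coherent \<omega> \<eta> x))" for i
    unfolding partial_def[abs_def] by (simp add: frechet_derivative_at[OF d1, symmetric])
  moreover have d2: "((\<lambda>x. k * (p i x * coherent \<omega> \<eta> x)) has_derivative
      (\<lambda>h. k * ((p i x * p h x - of_real (h \<bullet> i) / 2) * coherent \<omega> \<eta> x))) (at x)" for i x
  proof -
    have "((\<lambda>x. p i x) has_derivative (\<lambda>h. - of_real (h \<bullet> i) / 2)) (at x)"
      unfolding p_def by (rule derivative_eq_intros refl | simp)+
    from has_derivative_mult_right[OF has_derivative_mult[OF this coherent_has_derivative[of \<omega> \<eta> x]], of k]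
    show ?thesis by (rule has_derivative_eq_rhs) (simp add: p_def fun_eq_iff algebra_simps)
  qed
  ultimately have "partial i (partial i (\<lambda>x. k * coherent \<omega> \<eta> x)) x = k * (((p i x)\<^sup>2 - of_real (i \<bullet> i) / 2) * coherent \<omega> \<eta> x)" for i
    by (simp add: partial_def[of i "\<lambda>x. k * (p i x * coherent \<omega> \<eta> x)"] frechet_derivative_at[OF d2, symmetric] power2_eq_square)
  then have "laplacian (\<lambda>x. k * coherent \<omega> \<eta> x) x = (\<Sum>i\<in>Basis. (p i x)\<^sup>2 - of_real (i \<bullet> i) / 2) * (k * coherent \<omega> \<eta> x)"
    unfolding laplacian_def sum_distrib_right by (intro sum.cong refl) (simp add: mult_ac)
  also have "(\<Sum>i\<in>Basis. (p i x)\<^sup>2 - of_real (i \<bullet> i) / 2) =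
      (\<Sum>i\<in>Basis. \<eta>\<^sup>2 * of_real ((\<omega> \<bullet> i) * (\<omega> \<bullet> i)) - \<eta> * of_real ((x \<bullet> i) * (\<omega> \<bullet> i)) + of_real ((x \<bullet> i) * (x \<bullet> i)) / 4 - 1 / 2)"
    by (intro sum.cong refl) (simp add: p_def power2_eq_square inner_commute algebra_simps)
  also have "\<dots> = \<eta>\<^sup>2 * of_real (\<omega> \<bullet> \<omega>) - \<eta> * of_real (x \<bullet> \<omega>) + of_real (x \<bullet> x) / 4 - of_real DIM('a) / 2"
    by (simp only: sum.distrib sum_subtractf sum_distrib_left[symmetric] of_real_sum[symmetric] sum_divide_distrib[symmetric]
        euclidean_inner[symmetric]) simp
  finally show ?thesis
    using assms by (simp add: power2_norm_eq_inner[symmetric])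
qed

text \<open>The term |x|^2 / 4 of the Laplacian cancels the potential, so H acts here as
  multiplication by a polynomial of degree one in x. The state is itself a Schwartz function, so a
  constant sequence witnesses membership in the closure.\<close>

lemma harmonic_oscillator_coherent:
  fixes \<omega> :: "'a::euclidean_space"
  assumes "norm \<omega> = 1"
  shows "(\<lambda>x. k * coherent \<omega> \<eta> x, \<lambda>x. (\<eta>\<^sup>2 - of_real DIM('a) / 2 - \<eta> * of_real (x \<bullet> \<omega>)) * (k * coherent \<omega> \<eta> x)) \<in> harmonic_oscillator"
proof -
  have "(\<lambda>x. (\<eta>\<^sup>2 + (- of_real DIM('a) / 2) + (- \<eta>) * of_real (x \<bullet> \<omega>)) * coherent \<omega> \<eta> x) \<in> L2"
    by (intro poly_coherent_L2 poly_fun.intros)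
  from L2_cmult[OF this, of k] have 1: "(\<lambda>x. (\<eta>\<^sup>2 - of_real DIM('a) / 2 - \<eta> * of_real (x \<bullet> \<omega>)) * (k * coherent \<omega> \<eta> x)) \<in> L2"
    by (simp add: mult_ac)
  have 2: "(\<lambda>x. k * coherent \<omega> \<eta> x) \<in> Schwartz"
    by (intro poly_coherent_Schwartz poly_fun.intros)
  have 3: "(laplacian (\<lambda>x. k * coherent \<omega> \<eta> x) x - of_real ((norm x)\<^sup>2 / 4) * (k * coherent \<omega> \<eta> x)) - (\<eta>\<^sup>2 - of_real DIM('a) / 2 - \<eta> * of_real (x \<bullet> \<omega>)) * (k * coherent \<omega> \<eta> x) = 0" for x
    unfolding laplacian_coherent[OF assms] by (simp add: algebra_simps)
  show ?thesis unfolding harmonic_oscillator_def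
    using 1 L2_cmult[OF coherent_L2, of k \<omega> \<eta>] 2
    by (auto intro!: exI[of _ "\<lambda>n x. k * coherent \<omega> \<eta> x"] simp only: 3) (simp_all add: L2norm_def)
qed

text \<open>In the Bargmann picture \<open>e\<^sup>i\<^sup>t\<^sup>H\<close> is a rotation, up to a phase: it moves coherent states along circles.\<close>

definition coherent_flow :: "'a::euclidean_space \<Rightarrow> complex \<Rightarrow> real \<Rightarrow> 'a \<Rightarrow> complex" where
  "coherent_flow \<omega> \<zeta> t x =
     exp (- (\<i> * of_real (DIM('a) / 2 * t)) - (\<zeta> * cis (- t))\<^sup>2 / 2) * coherent \<omega> (\<zeta> * cis (- t)) x"

text \<open>Since \<eta>' = - \<i> \<eta>, the exponent \<eta> (x \<bullet> \<omega>) alone produces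
  only the term with x \<bullet> \<omega>. The factor exp (- \<eta>^2 / 2) supplies \<eta>^2 and the
  phase supplies the ground state energy, completing the action of \<i> H.\<close>

lemma coherent_flow_has_vector_derivative:
  fixes \<omega> x :: "'a::euclidean_space" and \<zeta> :: complex
  defines "\<eta> \<equiv> \<lambda>t. \<zeta> * cis (- t)"
  shows "((\<lambda>t. coherent_flow \<omega> \<zeta> t x) has_vector_derivative
      \<i> * (((\<eta> t)\<^sup>2 - of_real DIM('a) / 2 - \<eta> t * of_real (x \<bullet> \<omega>)) * coherent_flow \<omega> \<zeta> t x)) (at t)"
proof -
  \<comment> \<open>Time is made complex so that the rules for complex derivatives apply;
    restriction to the real line follows.\<close>
  define E where "E = (\<lambda>w. exp (- (\<i> * of_real (DIM('a) / 2) * w) - (\<zeta> * exp (- \<i> * w))\<^sup>2 / 2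
      + (\<zeta> * exp (- \<i> * w) * of_real (x \<bullet> \<omega>) - of_real ((norm x)\<^sup>2 / 4))))"
  have flow: "coherent_flow \<omega> \<zeta> t x = E (of_real t)" for t
    by (simp add: coherent_flow_def E_def coherent_def exp_add[symmetric] cis_conv_exp mult_ac add_ac)
  have "(E has_field_derivative \<i> * (((\<eta> t)\<^sup>2 - of_real DIM('a) / 2 - \<eta> t * of_real (x \<bullet> \<omega>)) * E (of_real t))) (at (of_real t))"
    unfolding E_def \<eta>_def cis_conv_exp
    by (rule derivative_eq_intros refl | simp)+ (simp add: algebra_simps power2_eq_square)
  from has_vector_derivative_real_field[OF this] show ?thesis by (simp add: flow o_def)
qed

text \<open>The rotation does not change the modulus of \<zeta>, so the bound is independent of t
  and can dominate the difference quotients in time.\<close>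

lemma coherent_flow_bound:
  fixes \<omega> x :: "'a::euclidean_space"
  assumes "norm \<omega> = 1"
  shows "cmod (((\<zeta> * cis (- t))\<^sup>2 - of_real DIM('a) / 2 - (\<zeta> * cis (- t)) * of_real (x \<bullet> \<omega>)) * coherent_flow \<omega> \<zeta> t x)
    \<le> ((cmod \<zeta>)\<^sup>2 + DIM('a) / 2 + cmod \<zeta>) * exp ((cmod \<zeta>)\<^sup>2 / 2) * ((1 + norm x) ^ 1 * exp (cmod \<zeta> * norm x - 1/4 * (norm x)\<^sup>2))"
proof -
  define \<eta> where "\<eta> = \<zeta> * cis (- t)"
  have \<eta>: "cmod \<eta> = cmod \<zeta>" by (simp add: \<eta>_def norm_mult)
  have "cmod (\<eta>\<^sup>2 - of_real DIM('a) / 2 - \<eta> * of_real (x \<bullet> \<omega>)) \<le> cmod (\<eta>\<^sup>2) + cmod (of_real DIM('a) / 2) + cmod (\<eta> * of_real (x \<bullet> \<omega>))"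
    by (intro order_trans[OF norm_triangle_ineq4] add_mono norm_triangle_ineq4) auto
  also have "\<dots> \<le> (cmod \<zeta>)\<^sup>2 + DIM('a) / 2 + cmod \<zeta> * norm x"
    using Cauchy_Schwarz_ineq2[of x \<omega>] assms by (auto simp: norm_mult norm_power \<eta> norm_divide intro!: mult_left_mono)
  also have "\<dots> \<le> ((cmod \<zeta>)\<^sup>2 + DIM('a) / 2 + cmod \<zeta>) * (1 + norm x)"
  proof -
    have "a + d + c * n \<le> (a + d + c) * (1 + n)" if "a \<ge> 0" "d \<ge> 0" "c \<ge> 0" "n \<ge> 0" for a d c n :: real
      using that mult_nonneg_nonneg[of "a + d" n] by (simp add: algebra_simps)
    then show ?thesis by simp
  qed
  finally have 1: "cmod (\<eta>\<^sup>2 - of_real DIM('a) / 2 - \<eta> * of_real (x \<bullet> \<omega>)) \<le> ((cmod \<zeta>)\<^sup>2 + DIM('a) / 2 + cmod \<zeta>) * (1 + norm x)" .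
  have "- Re (\<eta>\<^sup>2) \<le> cmod (\<eta>\<^sup>2)" using abs_Re_le_cmod[of "\<eta>\<^sup>2"] by linarith
  then have "exp (- Re (\<eta>\<^sup>2) / 2) \<le> exp ((cmod \<zeta>)\<^sup>2 / 2)" by (simp add: norm_power \<eta>)
  then have "cmod (coherent_flow \<omega> \<zeta> t x) \<le> exp ((cmod \<zeta>)\<^sup>2 / 2) * exp (cmod \<zeta> * norm x - 1/4 * (norm x)\<^sup>2)"
    using cmod_coherent_le[of \<omega> \<eta> x] assms
    unfolding coherent_flow_def \<eta>_def[symmetric] norm_mult by (intro mult_mono) (auto simp: \<eta>)
  from mult_mono[OF 1 this] show ?thesis
    unfolding \<eta>_def norm_mult by (simp add: mult_ac)
qed

lemma harmonic_oscillator_group_coherent: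
  fixes \<omega> :: "'a::euclidean_space"
  assumes U: "harmonic_oscillator_group U" and \<omega>: "norm \<omega> = 1"
  shows "AE x in lebesgue. U t (coherent_flow \<omega> \<zeta> 0) x = coherent_flow \<omega> \<zeta> t x"
proof -
  define G where "G = (\<lambda>t x. \<i> * (((\<zeta> * cis (- t))\<^sup>2 - of_real DIM('a) / 2 - (\<zeta> * cis (- t)) * of_real (x \<bullet> \<omega>)) * coherent_flow \<omega> \<zeta> t x))"
  have flow: "coherent_flow \<omega> \<zeta> t = (\<lambda>x. exp (- (\<i> * of_real (DIM('a) / 2 * t)) - (\<zeta> * cis (- t))\<^sup>2 / 2) * coherent \<omega> (\<zeta> * cis (- t)) x)" for t
    by (simp add: coherent_flow_def fun_eq_iff)
  have gen: "(coherent_flow \<omega> \<zeta> t, G t) \<in> generator U" for t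
  proof -
    have "(coherent_flow \<omega> \<zeta> t, \<lambda>x. ((\<zeta> * cis (- t))\<^sup>2 - of_real DIM('a) / 2 - (\<zeta> * cis (- t)) * of_real (x \<bullet> \<omega>)) * coherent_flow \<omega> \<zeta> t x) \<in> harmonic_oscillator"
      unfolding flow by (rule harmonic_oscillator_coherent[OF \<omega>])
    then show ?thesis using U unfolding harmonic_oscillator_group_def G_def by auto
  qed
  have L2: "coherent_flow \<omega> \<zeta> t \<in> L2" "G t \<in> L2" for t
    using gen[of t] by (auto simp: generator_def)
  define K where "K = ((cmod \<zeta>)\<^sup>2 + DIM('a) / 2 + cmod \<zeta>) * exp ((cmod \<zeta>)\<^sup>2 / 2)"
  show ?thesis
  proof (rule unitary_group_flow[where G = G])
    show "unitary_group U" using U by (simp add: harmonic_oscillator_group_def)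
    show "(coherent_flow \<omega> \<zeta> t, G t) \<in> generator U" for t by (rule gen)
    show "((\<lambda>h. L2norm (\<lambda>x. (coherent_flow \<omega> \<zeta> (t + h) x - coherent_flow \<omega> \<zeta> t x) / of_real h - G t x)) \<longlongrightarrow> 0) (at 0)" for t
    proof (rule L2_difference_quotient)
      show "((\<lambda>t. coherent_flow \<omega> \<zeta> t x) has_vector_derivative G t x) (at t)" for t x
        unfolding G_def by (rule coherent_flow_has_vector_derivative)
      show "cmod (G t x) \<le> K * ((1 + norm x) ^ 1 * exp (cmod \<zeta> * norm x - 1/4 * (norm x)\<^sup>2))" for t x
        using coherent_flow_bound[OF \<omega>, of \<zeta> t x] unfolding G_def K_def norm_mult[of \<i>] by simp
      have "(K * ((1 + norm x) ^ 1 * exp (cmod \<zeta> * norm x - 1/4 * (norm x)\<^sup>2)))\<^sup>2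
          = K\<^sup>2 * ((1 + norm x) ^ 2 * exp (2 * cmod \<zeta> * norm x - 1/2 * (norm x)\<^sup>2))" for x :: 'a
      proof -
        have "exp (2 * cmod \<zeta> * norm x - 1/2 * (norm x)\<^sup>2) = (exp (cmod \<zeta> * norm x - 1/4 * (norm x)\<^sup>2))\<^sup>2"
          unfolding exp_double[symmetric] by (simp add: algebra_simps)
        then show ?thesis by (simp only: power_mult_distrib power_one_right)
      qed
      then show "integrable lebesgue (\<lambda>x::'a. (K * ((1 + norm x) ^ 1 * exp (cmod \<zeta> * norm x - 1/4 * (norm x)\<^sup>2)))\<^sup>2)"
        by (simp only:) (intro integrable_mult_right poly_exp_gaussian_integrable, simp)
    qed (use L2 L2_D(1) in auto)
  qed
qed

text \<open>\<open>bargmann f \<omega>\<close> is the restriction of the Bargmann transform of \<open>f\<close> to the complex line \<open>\<complex> \<omega>\<close>,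
  for a unit vector \<open>\<omega>\<close>. These restrictions suffice, and they avoid holomorphy in several variables.\<close>

definition bargmann :: "('a::euclidean_space \<Rightarrow> complex) \<Rightarrow> 'a \<Rightarrow> complex \<Rightarrow> complex" where
  "bargmann f \<omega> \<zeta> = exp (- (\<zeta>\<^sup>2 / 2)) * (\<integral>x. f x * coherent \<omega> \<zeta> x \<partial>lebesgue)"

text \<open>The pairing in \<open>bargmann\<close> carries no conjugate, so it is an inner product
  with the state at cnj \<zeta>. The flow rotates that parameter by cis (- t), hence conjugation
  rotates \<zeta> by cis t; the phase is the ground state energy.\<close>

lemma bargmann_rotation:
  fixes f :: "'a::euclidean_space \<Rightarrow> complex"
  assumes U: "harmonic_oscillator_group U" and f: "f \<in> L2" and \<omega>: "norm \<omega> = 1"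
  shows "bargmann f \<omega> \<zeta> = cis (DIM('a) / 2 * t) * bargmann (U t f) \<omega> (cis t * \<zeta>)"
proof -
  have un: "unitary_op (U t)" using U by (simp add: harmonic_oscillator_group_def unitary_group_def)
  have flow: "coherent_flow \<omega> z t = (\<lambda>x. exp (- (\<i> * of_real (DIM('a) / 2 * t)) - (z * cis (- t))\<^sup>2 / 2) * coherent \<omega> (z * cis (- t)) x)" for t z
    by (simp add: coherent_flow_def fun_eq_iff)
  have L2[simp]: "coherent_flow \<omega> z t \<in> L2" for t z
    unfolding flow by (intro L2_cmult coherent_L2)
  have conj: "cnj (coherent \<omega> z x) = coherent \<omega> (cnj z) x" for z x
    by (simp add: coherent_def exp_cnj)
  have cf: "cnj (coherent_flow \<omega> (cnj \<zeta>) r x) = cis (DIM('a) / 2 * r) * (exp (- ((cis r * \<zeta>)\<^sup>2 / 2)) * coherent \<omega> (cis r * \<zeta>) x)" for r x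
  proof -
    have "cnj (exp (- (\<i> * of_real q) - (cnj \<zeta> * cis (- r))\<^sup>2 / 2)) = cis q * exp (- ((cis r * \<zeta>)\<^sup>2 / 2))" for q
      by (simp add: exp_cnj cis_conv_exp[of q] exp_add[symmetric] cis_cnj mult_ac)
    moreover have "cnj (coherent \<omega> (cnj \<zeta> * cis (- r)) x) = coherent \<omega> (cis r * \<zeta>) x"
      by (simp add: conj cis_cnj mult.commute)
    ultimately show ?thesis unfolding flow by (simp only: complex_cnj_mult mult.assoc)
  qed
  \<comment> \<open>r = 0 gives the left-hand side of the claim and r = t its right-hand side;
    invariance of the inner product under U t links them.\<close>
  have B: "cis (DIM('a) / 2 * r) * bargmann g \<omega> (cis r * \<zeta>) = (\<integral>x. g x * cnj (coherent_flow \<omega> (cnj \<zeta>) r x) \<partial>lebesgue)" for g r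
    unfolding cf bargmann_def integral_mult_right_zero[symmetric] by (simp only: mult_ac)
  have Lt: "U t f \<in> L2" "U t (coherent_flow \<omega> (cnj \<zeta>) 0) \<in> L2" using unitary_opD[OF un] f by auto
  note [measurable] = L2_D(1)[OF Lt(1)] L2_D(1)[OF L2_cnj[OF Lt(2)]] L2_D(1)[OF L2_cnj[OF L2[of "cnj \<zeta>" t]]]
  have "bargmann f \<omega> \<zeta> = (\<integral>x. f x * cnj (coherent_flow \<omega> (cnj \<zeta>) 0 x) \<partial>lebesgue)"
    using B[of 0 f] by simp
  also have "\<dots> = (\<integral>x. U t f x * cnj (U t (coherent_flow \<omega> (cnj \<zeta>) 0) x) \<partial>lebesgue)"
    by (intro unitary_op_inner[symmetric] un f L2)
  also have "\<dots> = (\<integral>x. U t f x * cnj (coherent_flow \<omega> (cnj \<zeta>) t x) \<partial>lebesgue)"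
    using harmonic_oscillator_group_coherent[OF U \<omega>, of t "cnj \<zeta>"] by (intro integral_cong_AE) auto
  finally show ?thesis by (simp only: B)
qed

section \<open>Uniqueness of the Fourier transform\<close>

lemma sigma_finite_lebesgue: "sigma_finite_measure (lebesgue :: 'a::euclidean_space measure)"
proof
  obtain A :: "'a set set" where A: "countable A" "A \<subseteq> sets lborel" "\<Union>A = space lborel" "\<forall>a\<in>A. emeasure lborel a \<noteq> \<infinity>"
    using lborel.sigma_finite_countable by blast
  then have "\<forall>a\<in>A. emeasure lebesgue a \<noteq> \<infinity>" by auto
  then show "\<exists>A. countable A \<and> A \<subseteq> sets lebesgue \<and> \<Union>A = space (lebesgue :: 'a measure) \<and> (\<forall>a\<in>A. emeasure lebesgue a \<noteq> \<infinity>)"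
    using A by (intro exI[of _ A]) (auto simp: subset_iff sets_completionI_sets)
qed

text \<open>Independent standard normal coordinates have a product characteristic function. It
  exhibits the Gaussian as an average of characters over a probability measure, so neither Fourier
  inversion nor its constants enter.\<close>

lemma gaussian_char:
  fixes y :: "'a::euclidean_space"
  shows "(\<integral>v. iexp (\<Sum>b\<in>Basis. v b * (y \<bullet> b)) \<partial>(\<Pi>\<^sub>M b\<in>(Basis :: 'a set). std_normal_distribution)) = exp (- (norm y)\<^sup>2 / 2)"
proof -
  interpret N: real_distribution std_normal_distribution by (rule real_dist_normal_dist)
  interpret product_prob_space "\<lambda>_::'a. std_normal_distribution" "Basis :: 'a set" by unfold_locales
  have "(\<integral>v. iexp (\<Sum>b\<in>Basis. v b * (y \<bullet> b)) \<partial>(\<Pi>\<^sub>M b\<in>(Basis :: 'a set). std_normal_distribution)) =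
     (\<integral>v. (\<Prod>b\<in>Basis. iexp ((y \<bullet> b) * v b)) \<partial>(\<Pi>\<^sub>M b\<in>(Basis :: 'a set). std_normal_distribution))"
    by (simp add: exp_sum[symmetric] sum_distrib_left mult.commute)
  also have "\<dots> = (\<Prod>b\<in>Basis. \<integral>t. iexp ((y \<bullet> b) * t) \<partial>std_normal_distribution)"
    by (intro product_integral_prod) (auto intro!: N.integrable_const_bound[of _ 1])
  also have "\<dots> = (\<Prod>b\<in>Basis. of_real (exp (- (y \<bullet> b)\<^sup>2 / 2)))"
    using fun_cong[OF char_std_normal_distribution] unfolding char_def by simp
  also have "\<dots> = exp (\<Sum>b\<in>Basis. - (y \<bullet> b)\<^sup>2 / 2)"
    by (simp add: exp_sum)
  also have "(\<Sum>b\<in>Basis. - (y \<bullet> b)\<^sup>2 / 2) = - (norm y)\<^sup>2 / 2"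
    unfolding power2_norm_eq_inner by (subst euclidean_inner) (simp add: power2_eq_square sum_negf sum_divide_distrib)
  finally show ?thesis .
qed

text \<open>The Gaussian is written as an average of characters and Fubini moves the integral
  against \<open>g\<close> inside, where it is a Fourier coefficient.\<close>

lemma fourier_zero_imp_gaussian_zero:
  fixes g :: "'a::euclidean_space \<Rightarrow> complex"
  assumes g: "integrable lebesgue g" and ft: "\<And>\<xi>. (\<integral>x. g x * iexp (x \<bullet> \<xi>) \<partial>lebesgue) = 0"
  shows "(\<integral>x. g x * of_real (exp (- (norm (\<sigma> *\<^sub>R (x - y)))\<^sup>2 / 2)) \<partial>lebesgue) = 0"
proof -
  define \<gamma> where "\<gamma> = (\<Pi>\<^sub>M b\<in>(Basis :: 'a set). std_normal_distribution)"
  interpret N: real_distribution std_normal_distribution by (rule real_dist_normal_dist)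
  interpret NP: product_prob_space "\<lambda>_::'a. std_normal_distribution" "Basis :: 'a set" by unfold_locales
  interpret L: sigma_finite_measure "lebesgue :: 'a measure" by (rule sigma_finite_lebesgue)
  interpret \<gamma>: prob_space \<gamma> unfolding \<gamma>_def by unfold_locales
  interpret LP: pair_sigma_finite "lebesgue :: 'a measure" \<gamma> by unfold_locales
  have [measurable]: "g \<in> borel_measurable lebesgue" using g by auto
  have [measurable]: "(\<lambda>x. x \<bullet> b) \<in> borel_measurable lebesgue" for b :: 'a
    by (intro borel_measurable_lebesgue_continuous continuous_intros)
  have [measurable]: "(\<lambda>v. v b) \<in> borel_measurable \<gamma>" if "b \<in> Basis" for b
    using measurable_component_singleton[OF that, of "\<lambda>_. std_normal_distribution"] unfolding \<gamma>_def by simp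
  let ?f = "\<lambda>x v. g x * iexp (\<Sum>b\<in>Basis. v b * (\<sigma> * (x \<bullet> b - y \<bullet> b)))"
  have fm[measurable]: "case_prod ?f \<in> borel_measurable (lebesgue \<Otimes>\<^sub>M \<gamma>)"
    by measurable
  have "integrable (lebesgue \<Otimes>\<^sub>M \<gamma>) (case_prod ?f)"
  proof (rule LP.Fubini_integrable)
    show "integrable lebesgue (\<lambda>x. \<integral>v. norm (case_prod ?f (x, v)) \<partial>\<gamma>)"
      using integrable_norm[OF g] by (simp add: norm_mult \<gamma>.prob_space)
    show "AE x in lebesgue. integrable \<gamma> (\<lambda>v. case_prod ?f (x, v))"
      by (intro AE_I2 \<gamma>.integrable_const_bound[of _ "norm (g x)" for x]) (auto simp: norm_mult)
  qed (rule fm)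
  then have swap: "(\<integral>x. (\<integral>v. ?f x v \<partial>\<gamma>) \<partial>lebesgue) = (\<integral>v. (\<integral>x. ?f x v \<partial>lebesgue) \<partial>\<gamma>)"
    by (rule LP.Fubini_integral[symmetric])
  have inner_v: "(\<integral>v. ?f x v \<partial>\<gamma>) = g x * of_real (exp (- (norm (\<sigma> *\<^sub>R (x - y)))\<^sup>2 / 2))" for x
    unfolding gaussian_char[of "\<sigma> *\<^sub>R (x - y)", symmetric] integral_mult_right_zero \<gamma>_def by (simp add: inner_diff_left)
  have inner_x: "(\<integral>x. ?f x v \<partial>lebesgue) = 0" for v
  proof -
    \<comment> \<open>The frequency seen by x; the shift by y contributes only a factor constant in
      x.\<close>
    define \<xi> where "\<xi> = \<sigma> *\<^sub>R (\<Sum>b\<in>Basis. v b *\<^sub>R b)"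
    have e: "(\<Sum>b\<in>Basis. v b * (\<sigma> * (x \<bullet> b - y \<bullet> b))) = x \<bullet> \<xi> - y \<bullet> \<xi>" for x
      by (simp add: \<xi>_def inner_sum_right sum_distrib_left algebra_simps sum_subtractf)
    have "?f x v = (g x * iexp (x \<bullet> \<xi>)) * iexp (- (y \<bullet> \<xi>))" for x
      unfolding e by (simp add: exp_diff exp_minus algebra_simps divide_inverse)
    then show ?thesis by (simp only: integral_mult_left_zero ft) simp
  qed
  show ?thesis using swap unfolding inner_v inner_x by simp
qed

lemma lborel_integral_affine:
  fixes h :: "'a::euclidean_space \<Rightarrow> 'b::{banach, second_countable_topology}"
  assumes [measurable]: "h \<in> borel_measurable borel" and "c \<noteq> 0"
  shows "(\<integral>x. h x \<partial>lborel) = \<bar>c\<bar> ^ DIM('a) *\<^sub>R (\<integral>x. h (t + c *\<^sub>R x) \<partial>lborel)"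
  using assms(2) by (subst lborel_affine[of c t]) (simp_all add: integral_density integral_distr)

text \<open>Gaussians form an approximate identity. Integrability of \<psi> justifies Fubini for the
  smoothed function \<Psi>, while boundedness and continuity give \<Psi> \<sigma> x \<rightarrow> c
  \<psi> x with a domination as \<sigma> grows.\<close>

lemma gaussian_zero_imp_continuous_zero:
  fixes g :: "'a::euclidean_space \<Rightarrow> complex" and \<psi> :: "'a \<Rightarrow> real"
  assumes g: "integrable lebesgue g"
    and gz: "\<And>\<sigma> y. (\<integral>x. g x * of_real (exp (- (norm (\<sigma> *\<^sub>R (x - y)))\<^sup>2 / 2)) \<partial>lebesgue) = 0"
    and cont: "continuous_on UNIV \<psi>" and bd: "\<And>x. \<bar>\<psi> x\<bar> \<le> B" and int: "integrable lborel \<psi>"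
  shows "(\<integral>x. g x * of_real (\<psi> x) \<partial>lebesgue) = 0"
proof -
  interpret L: sigma_finite_measure "lebesgue :: 'a measure" by (rule sigma_finite_lebesgue)
  interpret LP: pair_sigma_finite "lebesgue :: 'a measure" "lborel :: 'a measure" by unfold_locales
  have [measurable]: "g \<in> borel_measurable lebesgue" using g by auto
  have [measurable]: "\<psi> \<in> borel_measurable borel" using cont by (rule borel_measurable_continuous_onI)
  define K where "K = (\<lambda>z::'a. exp (- (norm z)\<^sup>2 / 2))"
  have [measurable]: "K \<in> borel_measurable borel" unfolding K_def by measurable
  have \<psi>K: "(\<lambda>z. \<psi> (x + c *\<^sub>R z) * K z) \<in> borel_measurable lborel" for x c
    by measurable
  have K\<psi>: "(\<lambda>z. \<psi> x * K z) \<in> borel_measurable lborel" for x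
    by measurable
  have [measurable]: "(\<lambda>x::'a. x) \<in> measurable lebesgue borel"
    by (intro borel_measurable_lebesgue_continuous continuous_intros)
  have K1: "\<bar>K z\<bar> \<le> 1" "K z > 0" for z by (auto simp: K_def)
  have Kint: "integrable lborel K"
  proof -
    have "integrable lebesgue K"
      using gaussian_integrable[of "1/2", where 'a='a] by (simp add: K_def)
    then show ?thesis by (subst (asm) integrable_completion) auto
  qed
  define \<Psi> where "\<Psi> = (\<lambda>\<sigma> x. \<integral>z. \<psi> (x + (1/\<sigma>) *\<^sub>R z) * K z \<partial>lborel)"
  have \<Psi>0: "(\<integral>x. g x * of_real (\<Psi> \<sigma> x) \<partial>lebesgue) = 0" if "\<sigma> > 0" for \<sigma>
  proof -
    let ?f = "\<lambda>x y. g x * of_real (\<psi> y * K (\<sigma> *\<^sub>R (x - y)))"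
    have fm[measurable]: "case_prod ?f \<in> borel_measurable (lebesgue \<Otimes>\<^sub>M lborel)"
      by measurable
    have "integrable (lebesgue \<Otimes>\<^sub>M lborel) (case_prod ?f)"
    proof (rule Bochner_Integration.integrable_bound)
      show "integrable (lebesgue \<Otimes>\<^sub>M lborel) (\<lambda>(x, y). g x * of_real (\<psi> y))"
      proof (rule LP.Fubini_integrable)
        show "integrable lebesgue (\<lambda>x. \<integral>y. norm ((\<lambda>(x, y). g x * of_real (\<psi> y)) (x, y)) \<partial>lborel)"
          using integrable_norm[OF g] by (simp add: norm_mult)
        show "AE x in lebesgue. integrable lborel (\<lambda>y. (\<lambda>(x, y). g x * of_real (\<psi> y)) (x, y))"
          unfolding prod.case by (intro AE_I2 integrable_mult_right integrable_of_real int)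
      qed measurable
      show "AE p in lebesgue \<Otimes>\<^sub>M lborel. norm (case_prod ?f p) \<le> norm ((\<lambda>(x, y). g x * of_real (\<psi> y)) p)"
        using K1 by (intro AE_I2) (auto simp: norm_mult abs_mult split_beta intro!: mult_left_le mult_left_mono)
    qed (rule fm)
    then have swap: "(\<integral>x. (\<integral>y. ?f x y \<partial>lborel) \<partial>lebesgue) = (\<integral>y. (\<integral>x. ?f x y \<partial>lebesgue) \<partial>lborel)"
      by (rule LP.Fubini_integral[symmetric])
    have inner_x: "(\<integral>x. ?f x y \<partial>lebesgue) = 0" for y
    proof -
      have "?f x y = of_real (\<psi> y) * (g x * of_real (exp (- (norm (\<sigma> *\<^sub>R (x - y)))\<^sup>2 / 2)))" for x
        by (simp add: K_def)
      then show ?thesis by (simp only: integral_mult_right_zero gz) simp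
    qed
    have inner_y: "(\<integral>y. ?f x y \<partial>lborel) = of_real (\<bar>1/\<sigma>\<bar> ^ DIM('a)) * (g x * of_real (\<Psi> \<sigma> x))" for x
    proof -
      have "(\<integral>y. ?f x y \<partial>lborel) = g x * of_real (\<integral>y. \<psi> y * K (\<sigma> *\<^sub>R (x - y)) \<partial>lborel)"
        by (simp only: integral_mult_right_zero integral_complex_of_real)
      also have "(\<integral>y. \<psi> y * K (\<sigma> *\<^sub>R (x - y)) \<partial>lborel) = \<bar>1/\<sigma>\<bar> ^ DIM('a) *\<^sub>R (\<integral>z. \<psi> (x + (1/\<sigma>) *\<^sub>R z) * K (\<sigma> *\<^sub>R (x - (x + (1/\<sigma>) *\<^sub>R z))) \<partial>lborel)"
        by (rule lborel_integral_affine) (use that in auto)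
      also have "(\<lambda>z. \<psi> (x + (1/\<sigma>) *\<^sub>R z) * K (\<sigma> *\<^sub>R (x - (x + (1/\<sigma>) *\<^sub>R z)))) = (\<lambda>z. \<psi> (x + (1/\<sigma>) *\<^sub>R z) * K z)"
        using that by (simp add: K_def)
      finally show ?thesis unfolding \<Psi>_def by simp
    qed
    have "of_real (\<bar>1/\<sigma>\<bar> ^ DIM('a)) * (\<integral>x. g x * of_real (\<Psi> \<sigma> x) \<partial>lebesgue) = (0::complex)"
      using swap[unfolded inner_x inner_y] by (simp only: integral_mult_right_zero Bochner_Integration.integral_zero)
    then show ?thesis using that by simp
  qed
  \<comment> \<open>The kernel is left unnormalised, so its total mass \<open>c\<close> appears in
    the limit and must be shown nonzero before it is divided out.\<close>
  define c where "c = (\<integral>z. K z \<partial>lborel)"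
  have "c \<noteq> 0"
  proof
    assume "c = 0"
    then have "AE z in lborel. K z = 0"
      unfolding c_def using K1(2) by (subst (asm) integral_nonneg_eq_0_iff_AE[OF Kint]) (auto intro: less_imp_le)
    then have "AE z::'a in lborel. False" using K1(2) by (simp add: less_imp_neq[symmetric])
    then show False by (simp add: AE_iff_null null_sets_def)
  qed
  have B0: "B \<ge> 0" using order_trans[OF abs_ge_zero bd] .
  have lim: "(\<lambda>n. \<Psi> (real (Suc n)) x) \<longlonglongrightarrow> \<psi> x * c" for x
    unfolding \<Psi>_def c_def integral_mult_right_zero[symmetric]
  proof (rule integral_dominated_convergence)
    show "integrable lborel (\<lambda>z. B * K z)" using Kint by simp
    show "AE z in lborel. (\<lambda>n. \<psi> (x + (1 / real (Suc n)) *\<^sub>R z) * K z) \<longlonglongrightarrow> \<psi> x * K z"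
    proof (intro AE_I2 tendsto_mult tendsto_const)
      fix z
      have "(\<lambda>n. x + (1 / real (Suc n)) *\<^sub>R z) \<longlonglongrightarrow> x + 0 *\<^sub>R z"
        using LIMSEQ_inverse_real_of_nat by (intro tendsto_intros) (simp add: inverse_eq_divide)
      then show "(\<lambda>n. \<psi> (x + (1 / real (Suc n)) *\<^sub>R z)) \<longlonglongrightarrow> \<psi> x"
        using continuous_on_tendsto_compose[OF cont, of "\<lambda>n. x + (1 / real (Suc n)) *\<^sub>R z" x] by simp
    qed
    show "AE z in lborel. norm (\<psi> (x + (1 / real (Suc n)) *\<^sub>R z) * K z) \<le> B * K z" for n
      using bd K1(2) by (intro AE_I2) (auto simp: abs_mult abs_of_pos intro!: mult_right_mono less_imp_le)
  qed (rule \<psi>K K\<psi>)+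
  have \<Psi>bd: "\<bar>\<Psi> \<sigma> x\<bar> \<le> B * c" for \<sigma> x
  proof -
    have "\<bar>\<Psi> \<sigma> x\<bar> \<le> (\<integral>z. B * K z \<partial>lborel)"
      unfolding \<Psi>_def real_norm_def[symmetric]
      by (rule Bochner_Integration.integral_norm_bound_integral)
         (use bd K1 Kint B0 in \<open>auto simp: abs_mult abs_of_pos intro!: mult_right_mono less_imp_le
           Bochner_Integration.integrable_bound[OF integrable_mult_right[OF Kint, of B]]\<close>)
    then show ?thesis by (simp add: c_def)
  qed
  have [measurable]: "\<Psi> \<sigma> \<in> borel_measurable lebesgue" for \<sigma>
    unfolding \<Psi>_def by measurable
  have "(\<lambda>n. \<integral>x. g x * of_real (\<Psi> (real (Suc n)) x) \<partial>lebesgue) \<longlonglongrightarrow> (\<integral>x. g x * of_real (\<psi> x * c) \<partial>lebesgue)"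
  proof (rule integral_dominated_convergence)
    show "integrable lebesgue (\<lambda>x. norm (g x) * (B * c))" using integrable_norm[OF g] by simp
    show "AE x in lebesgue. (\<lambda>n. g x * of_real (\<Psi> (real (Suc n)) x)) \<longlonglongrightarrow> g x * of_real (\<psi> x * c)"
      by (intro AE_I2 tendsto_intros lim)
    show "AE x in lebesgue. norm (g x * of_real (\<Psi> (real (Suc n)) x)) \<le> norm (g x) * (B * c)" for n
      using \<Psi>bd by (intro AE_I2) (simp add: norm_mult mult_left_mono)
  qed measurable
  then have "(\<integral>x. g x * of_real (\<psi> x * c) \<partial>lebesgue) = 0"
    using \<Psi>0 by (simp add: LIMSEQ_const_iff)
  then have "of_real c * (\<integral>x. g x * of_real (\<psi> x) \<partial>lebesgue) = 0"
    unfolding integral_mult_right_zero[symmetric] by (simp add: mult_ac)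
  then show ?thesis using \<open>c \<noteq> 0\<close> by simp
qed

text \<open>Tent functions of the distance to \<open>K\<close> decrease to its indicator, since
  \<open>K\<close> is closed. The slope is at least 1, which keeps all supports in the compact
  neighbourhood of radius 1 and makes the tents integrable.\<close>

lemma continuous_zero_imp_compact_zero:
  fixes g :: "'a::euclidean_space \<Rightarrow> complex"
  assumes g: "integrable lebesgue g"
    and cz: "\<And>(\<psi> :: 'a \<Rightarrow> real) B. continuous_on UNIV \<psi> \<Longrightarrow> (\<And>x. \<bar>\<psi> x\<bar> \<le> B) \<Longrightarrow> integrable lborel \<psi> \<Longrightarrow>
        (\<integral>x. g x * of_real (\<psi> x) \<partial>lebesgue) = 0"
    and K: "compact K"
  shows "(\<integral>x. g x * of_real (indicator K x) \<partial>lebesgue) = 0"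
proof (cases "K = {}")
  \<comment> \<open>\<open>infdist\<close> to the empty set is 0 by convention, which would make
    every tent constantly 1; the empty set is therefore separated.\<close>
  case False
  have [measurable]: "g \<in> borel_measurable lebesgue" using g by auto
  define \<psi> where "\<psi> = (\<lambda>n x. max 0 (1 - real (Suc n) * infdist x K))"
  have cont: "continuous_on UNIV (\<psi> n)" for n
    unfolding \<psi>_def by (intro continuous_intros)
  have [measurable]: "\<psi> n \<in> borel_measurable lebesgue" for n
    by (rule borel_measurable_lebesgue_continuous[OF cont])
  have bd: "\<bar>\<psi> n x\<bar> \<le> 1" for n x by (simp add: \<psi>_def infdist_nonneg)
  have supp: "\<psi> n x = 0" if "x \<notin> {x. infdist x K \<le> 1}" for n x
  proof -
    have "1 * 1 \<le> real (Suc n) * infdist x K" using that by (intro mult_mono) auto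
    then show ?thesis by (simp add: \<psi>_def)
  qed
  have comp: "compact {x. infdist x K \<le> 1}" using compact_infdist_le[OF False K, of 1] by simp
  have int: "integrable lborel (\<psi> n)" for n
  proof (rule integrable_by_bound)
    show "integrable lborel (indicator {x. infdist x K \<le> 1} :: 'a \<Rightarrow> real)"
      using borel_compact[OF comp] emeasure_bounded_finite[OF compact_imp_bounded[OF comp]] by (intro integrable_real_indicator) simp_all
    show "\<psi> n \<in> borel_measurable lborel" using borel_measurable_continuous_onI[OF cont] by simp
    show "norm (\<psi> n x) \<le> indicator {x. infdist x K \<le> 1} x" for x
      using bd[of n x] supp[of x n] by (auto simp: indicator_def)
  qed
  have lim: "(\<lambda>n. \<psi> n x) \<longlonglongrightarrow> indicator K x" for x
  proof (cases "x \<in> K")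
    case True
    then show ?thesis by (simp add: \<psi>_def)
  next
    case False
    then have "infdist x K > 0"
      using in_closed_iff_infdist_zero[OF compact_imp_closed[OF K] \<open>K \<noteq> {}\<close>] infdist_nonneg[of x K] by force
    then obtain N where N: "1 / infdist x K < real N" using reals_Archimedean2 by blast
    have "\<psi> n x = 0" if "n \<ge> N" for n
    proof -
      have "1 / infdist x K \<le> real (Suc n)" using N that by linarith
      then show ?thesis using \<open>infdist x K > 0\<close> by (simp add: \<psi>_def field_simps)
    qed
    then have "\<forall>\<^sub>F n in sequentially. \<psi> n x = indicator K x"
      using False by (auto simp: eventually_sequentially)
    then show ?thesis by (rule tendsto_eventually)
  qed
  have [measurable]: "K \<in> sets lebesgue" using borel_compact[OF K] by auto
  have "(\<lambda>n. \<integral>x. g x * of_real (\<psi> n x) \<partial>lebesgue) \<longlonglongrightarrow> (\<integral>x. g x * of_real (indicator K x) \<partial>lebesgue)"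
  proof (rule integral_dominated_convergence)
    show "integrable lebesgue (\<lambda>x. norm (g x))" using g by simp
    show "AE x in lebesgue. (\<lambda>n. g x * of_real (\<psi> n x)) \<longlonglongrightarrow> g x * of_real (indicator K x)"
      by (intro AE_I2 tendsto_intros lim)
    show "AE x in lebesgue. norm (g x * of_real (\<psi> n x)) \<le> norm (g x)" for n
      using bd by (intro AE_I2) (simp add: norm_mult mult_left_le)
  qed measurable
  then show ?thesis using cz[OF cont bd int] by (simp add: LIMSEQ_const_iff)
qed simp

text \<open>Up to a null set a Lebesgue set is a countable union of compact sets. Finite unions of
  these are compact and increase to it, so the integral of \<open>g\<close> vanishes over every
  measurable set.\<close>

lemma compact_zero_imp_AE_zero:
  fixes g :: "'a::euclidean_space \<Rightarrow> complex"
  assumes g: "integrable lebesgue g"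
    and cz: "\<And>K. compact K \<Longrightarrow> (\<integral>x. g x * of_real (indicator K x) \<partial>lebesgue) = 0"
  shows "AE x in lebesgue. g x = 0"
proof -
  interpret L: sigma_finite_measure "lebesgue :: 'a measure" by (rule sigma_finite_lebesgue)
  have gm[measurable]: "g \<in> borel_measurable lebesgue" using g by auto
  show ?thesis
  proof (rule L.density_zero[OF g])
    fix A :: "'a set" assume A: "A \<in> sets lebesgue"
    then obtain C T where CT: "fsigma C" "T \<in> null_sets lebesgue" "C \<union> T = A" "disjnt C T"
      by (rule lebesgue_set_almost_fsigma)
    obtain F :: "nat \<Rightarrow> 'a set" where F: "range F \<subseteq> Collect compact" "C = \<Union>(range F)"
      using CT(1) fsigma_Union_compact by metis
    define H where "H = (\<lambda>n. \<Union>i\<le>n. F i)"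
    have H: "compact (H n)" for n unfolding H_def using F(1) by (intro compact_UN) auto
    have [measurable]: "H n \<in> sets lebesgue" for n using borel_compact[OF H] by auto
    have C[measurable]: "C \<in> sets lebesgue"
      unfolding F(2)
    proof (intro sets.countable_UN subsetI)
      fix S assume "S \<in> range F"
      then have "S \<in> sets borel" using F(1) by (auto intro: borel_compact)
      then show "S \<in> sets lebesgue" by simp
    qed
    have lim: "(\<lambda>n. indicator (H n) x :: real) \<longlonglongrightarrow> indicator C x" for x
    proof -
      have "incseq H" unfolding H_def incseq_def by (intro allI impI UN_mono) auto
      moreover have "(\<Union>n. H n) = C" by (auto simp: F(2) H_def)
      ultimately show ?thesis using LIMSEQ_indicator_incseq[of H x] by simp
    qed
    have "(\<lambda>n. \<integral>x. g x * of_real (indicator (H n) x) \<partial>lebesgue) \<longlonglongrightarrow> (\<integral>x. g x * of_real (indicator C x) \<partial>lebesgue)"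
    proof (rule integral_dominated_convergence)
      show "integrable lebesgue (\<lambda>x. norm (g x))" using g by simp
      show "AE x in lebesgue. (\<lambda>n. g x * of_real (indicator (H n) x)) \<longlonglongrightarrow> g x * of_real (indicator C x)"
        by (intro AE_I2 tendsto_intros lim)
      show "AE x in lebesgue. norm (g x * of_real (indicator (H n) x)) \<le> norm (g x)" for n
        by (intro AE_I2) (simp add: norm_mult indicator_def)
    qed measurable
    then have "(\<integral>x. g x * of_real (indicator C x) \<partial>lebesgue) = 0"
      using cz[OF H] by (simp add: LIMSEQ_const_iff)
    moreover have "(\<integral>x. g x * of_real (indicator C x) \<partial>lebesgue) = (\<integral>x. indicator A x *\<^sub>R g x \<partial>lebesgue)"
    proof (rule integral_cong_AE)
      show "AE x in lebesgue. g x * of_real (indicator C x) = indicator A x *\<^sub>R g x"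
        using AE_not_in[OF CT(2)] by eventually_elim (use CT(3) in \<open>auto simp: indicator_def\<close>)
    qed (use A in measurable)
    ultimately show "set_lebesgue_integral lebesgue A g = 0"
      by (simp add: set_lebesgue_integral_def)
  qed
qed

lemma fourier_uniqueness:
  fixes g :: "'a::euclidean_space \<Rightarrow> complex"
  assumes g: "integrable lebesgue g" and ft: "\<And>\<xi>. (\<integral>x. g x * iexp (x \<bullet> \<xi>) \<partial>lebesgue) = 0"
  shows "AE x in lebesgue. g x = 0"
  using compact_zero_imp_AE_zero[OF g continuous_zero_imp_compact_zero[OF g
        gaussian_zero_imp_continuous_zero[OF g fourier_zero_imp_gaussian_zero[OF g ft]]]] .

section \<open>Growth of the Bargmann transform\<close>

lemma exp_norm_gaussian_L2:
  "(\<lambda>x::'a::euclidean_space. complex_of_real (exp (C * norm x - (norm x)\<^sup>2 / 4))) \<in> L2"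
proof -
  have "(cmod (complex_of_real (exp (C * norm x - (norm x)\<^sup>2 / 4))))\<^sup>2 = (1 + norm x) ^ 0 * exp (2 * C * norm x - 1/2 * (norm x)\<^sup>2)" for x :: 'a
    by (simp add: exp_double[symmetric] algebra_simps)
  moreover have "integrable lebesgue (\<lambda>x::'a. (1 + norm x) ^ 0 * exp (2 * C * norm x - 1/2 * (norm x)\<^sup>2))"
    by (rule poly_exp_gaussian_integrable) simp
  moreover have "(\<lambda>x::'a. complex_of_real (exp (C * norm x - (norm x)\<^sup>2 / 4))) \<in> borel_measurable lebesgue"
    by (intro borel_measurable_lebesgue_continuous continuous_intros) simp
  ultimately show ?thesis by (simp only: L2_def mem_Collect_eq simp_thms)
qed

text \<open>Expanding exp (\<zeta> (x \<bullet> \<omega>)) and integrating term by term gives a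
  power series that converges in the whole plane, so no differentiation under the integral is
  needed.\<close>

lemma bargmann_holomorphic:
  fixes f :: "'a::euclidean_space \<Rightarrow> complex"
  assumes f: "f \<in> L2"
  shows "bargmann f \<omega> holomorphic_on UNIV"
proof -
  note fm[measurable] = L2_D(1)[OF f]
  have om[measurable]: "(\<lambda>x. x \<bullet> \<omega>) \<in> borel_measurable lebesgue" "(\<lambda>x::'a. norm x) \<in> borel_measurable lebesgue"
    by (intro borel_measurable_lebesgue_continuous continuous_intros)+
  define G where "G = (\<lambda>n x. f x * (of_real (x \<bullet> \<omega>) ^ n /\<^sub>R fact n * of_real (exp (- (norm x)\<^sup>2 / 4))))"
  have "(\<lambda>n. (\<integral>x. G n x \<partial>lebesgue) * (\<zeta> - 0) ^ n) sums (\<integral>x. f x * coherent \<omega> \<zeta> x \<partial>lebesgue)" for \<zeta>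
  proof -
    define M where "M = (\<lambda>x. cmod (f x) * exp (cmod \<zeta> * norm \<omega> * norm x - (norm x)\<^sup>2 / 4))"
    have M: "integrable lebesgue M"
      using integrable_norm[OF L2_integrable_mult[OF f exp_norm_gaussian_L2[of "cmod \<zeta> * norm \<omega>"]]]
      by (simp add: M_def norm_mult)
    have summand: "G n x * \<zeta> ^ n = f x * of_real (exp (- (norm x)\<^sup>2 / 4)) * ((\<zeta> * of_real (x \<bullet> \<omega>)) ^ n /\<^sub>R fact n)" for n x
      by (simp add: G_def power_mult_distrib scaleR_conv_of_real)
    have coherent: "coherent \<omega> \<zeta> x = of_real (exp (- (norm x)\<^sup>2 / 4)) * exp (\<zeta> * of_real (x \<bullet> \<omega>))" for x
    proof -
      have "\<zeta> * of_real (x \<bullet> \<omega>) - of_real ((norm x)\<^sup>2 / 4) = of_real (- (norm x)\<^sup>2 / 4) + \<zeta> * of_real (x \<bullet> \<omega>)"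
        by simp
      then show ?thesis by (simp only: coherent_def exp_of_real exp_add)
    qed
    have sums: "(\<lambda>n. G n x * \<zeta> ^ n) sums (f x * coherent \<omega> \<zeta> x)" for x
      using sums_mult[OF exp_converges[of "\<zeta> * of_real (x \<bullet> \<omega>)"], of "f x * of_real (exp (- (norm x)\<^sup>2 / 4))"]
      unfolding summand by (simp only: coherent) (simp only: mult_ac)
    have absums: "(\<lambda>n. norm (G n x * \<zeta> ^ n)) sums (cmod (f x) * exp (- (norm x)\<^sup>2 / 4) * exp (cmod \<zeta> * \<bar>x \<bullet> \<omega>\<bar>))" for x
      using sums_mult[OF exp_converges[of "cmod \<zeta> * \<bar>x \<bullet> \<omega>\<bar>"], of "cmod (f x) * exp (- (norm x)\<^sup>2 / 4)"]
      unfolding summand by (simp add: norm_mult norm_power mult_ac)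
    have le: "cmod (f x) * exp (- (norm x)\<^sup>2 / 4) * exp (cmod \<zeta> * \<bar>x \<bullet> \<omega>\<bar>) \<le> M x" for x
    proof -
      have "cmod \<zeta> * \<bar>x \<bullet> \<omega>\<bar> \<le> cmod \<zeta> * (norm x * norm \<omega>)"
        by (intro mult_left_mono Cauchy_Schwarz_ineq2) auto
      then have "exp (- (norm x)\<^sup>2 / 4 + cmod \<zeta> * \<bar>x \<bullet> \<omega>\<bar>) \<le> exp (cmod \<zeta> * norm \<omega> * norm x - (norm x)\<^sup>2 / 4)"
        by (simp add: mult_ac)
      from mult_left_mono[OF this norm_ge_zero[of "f x"]] show ?thesis
        by (simp only: M_def exp_add mult.assoc)
    qed
    \<comment> \<open>One integrable function dominates all partial sums of absolute values; this
      yields both integrability of the terms and summability of their integrals.\<close>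
    have part: "(\<Sum>i\<in>I. norm (G i x * \<zeta> ^ i)) \<le> M x" if "finite I" for x I
      using sum_le_suminf[OF sums_summable[OF absums] that, of x] sums_unique[OF absums, of x] le[of x] by simp
    have intG: "integrable lebesgue (\<lambda>x. G n x * \<zeta> ^ n)" for n
    proof (rule integrable_by_bound[OF M])
      show "(\<lambda>x. G n x * \<zeta> ^ n) \<in> borel_measurable lebesgue" unfolding G_def by measurable
      show "norm (G n x * \<zeta> ^ n) \<le> M x" for x using part[of "{n}" x] by simp
    qed
    have "summable (\<lambda>n. \<integral>x. norm (G n x * \<zeta> ^ n) \<partial>lebesgue)"
    proof (rule summableI_nonneg_bounded)
      fix n
      have "(\<Sum>i<n. \<integral>x. norm (G i x * \<zeta> ^ i) \<partial>lebesgue) = (\<integral>x. (\<Sum>i<n. norm (G i x * \<zeta> ^ i)) \<partial>lebesgue)"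
        by (intro Bochner_Integration.integral_sum[symmetric] integrable_norm intG)
      also have "\<dots> \<le> (\<integral>x. M x \<partial>lebesgue)"
        by (intro integral_mono Bochner_Integration.integrable_sum integrable_norm intG M part) auto
      finally show "(\<Sum>i<n. \<integral>x. norm (G i x * \<zeta> ^ i) \<partial>lebesgue) \<le> (\<integral>x. M x \<partial>lebesgue)" .
    qed auto
    then have "(\<lambda>n. \<integral>x. G n x * \<zeta> ^ n \<partial>lebesgue) sums (\<integral>x. (\<Sum>n. G n x * \<zeta> ^ n) \<partial>lebesgue)"
      using absums by (intro sums_integral intG) (auto simp: sums_iff)
    moreover have "(\<Sum>n. G n x * \<zeta> ^ n) = f x * coherent \<omega> \<zeta> x" for x
      using sums by (simp add: sums_iff)
    ultimately show ?thesis by simp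
  qed
  then have "(\<lambda>\<zeta>. \<integral>x. f x * coherent \<omega> \<zeta> x \<partial>lebesgue) holomorphic_on ball 0 r" for r
    by (rule power_series_holomorphic)
  then have "(\<lambda>\<zeta>. \<integral>x. f x * coherent \<omega> \<zeta> x \<partial>lebesgue) holomorphic_on (\<Union>r::real. ball 0 r)"
    by (intro holomorphic_on_UN_open) auto
  moreover have "(\<Union>r::real. ball (0::complex) r) = UNIV"
    by (auto intro: gt_ex)
  ultimately show ?thesis
    unfolding bargmann_def[abs_def] by (intro holomorphic_intros) auto
qed

lemma lebesgue_integral_translation:
  fixes f :: "'a::euclidean_space \<Rightarrow> real"
  assumes [measurable]: "f \<in> borel_measurable borel"
  shows "(\<integral>x. f (x - v) \<partial>lebesgue) = (\<integral>x. f x \<partial>lebesgue)"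
proof -
  have "(\<integral>x. f (x - v) \<partial>lborel) = (\<integral>x. f x \<partial>lborel)"
    using lborel_integral_affine[of f 1 "- v"] by simp
  then show ?thesis by (simp add: integral_completion)
qed

text \<open>Completing the square in a |x|^2 + |x|^2 / 4 - r (x \<bullet> \<omega>) leaves exp (r^2
  / (4 a + 1)) times a Gaussian centred at v r. Cauchy--Schwarz puts its square root
  \<open>e\<close> on the L2 function \<open>h\<close> and again on a factor of norm N, independent
  of r. The first norm is the source of the decay: as r grows the window \<open>e\<close> moves away
  from the mass of \<open>h\<close>.\<close>

lemma bargmann_growth:
  fixes f :: "'a::euclidean_space \<Rightarrow> complex" and a :: real
  assumes f: "f \<in> L2" and a: "a > 0" and h: "(\<lambda>x. of_real (exp (a * (norm x)\<^sup>2)) * f x) \<in> L2"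
    and \<omega>: "norm \<omega> = 1"
  obtains J C where "\<And>r. J r \<le> C" "\<And>c. c \<noteq> 0 \<Longrightarrow> (\<lambda>n. J (c * real n)) \<longlonglongrightarrow> 0"
    "\<And>\<zeta>. cmod (bargmann f \<omega> \<zeta>) \<le> J (Re \<zeta>) * exp (1 / (4 * a + 1) * (Re \<zeta>)\<^sup>2 - Re (\<zeta>\<^sup>2) / 2)"
proof -
  define \<kappa> where "\<kappa> = a + 1/4"
  have \<kappa>: "\<kappa> > 0" using a by (simp add: \<kappa>_def)
  define v where "v = (\<lambda>r. (r / (2 * \<kappa>)) *\<^sub>R \<omega>)"
  define h where "h = (\<lambda>x. of_real (exp (a * (norm x)\<^sup>2)) * f x)"
  have hL2: "h \<in> L2" using h by (simp add: h_def)
  note hm[measurable] = L2_D(1)[OF hL2]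
  define e where "e = (\<lambda>r x. exp (- (\<kappa> / 2) * (norm (x - v r))\<^sup>2))"
  have em[measurable]: "e r \<in> borel_measurable lebesgue" for r
    unfolding e_def by (intro borel_measurable_lebesgue_continuous continuous_intros)
  have e1: "0 < e r x" "e r x \<le> 1" for r x using \<kappa> by (auto simp: e_def)
  have e2: "(e r x)\<^sup>2 = exp (- \<kappa> * (norm (x - v r))\<^sup>2)" for r x
    by (simp add: e_def exp_double[symmetric])
  have eL2: "(\<lambda>x. complex_of_real (e r x)) \<in> L2" for r
  proof -
    have "integrable lebesgue (\<lambda>x. exp (- \<kappa> * (norm (x - v r))\<^sup>2))"
    proof (rule integrable_by_bound[OF poly_exp_gaussian_integrable[OF \<kappa>, of 0 "2 * \<kappa> * norm (v r)"]])
      show "norm (exp (- \<kappa> * (norm (x - v r))\<^sup>2)) \<le> (1 + norm x) ^ 0 * exp (2 * \<kappa> * norm (v r) * norm x - \<kappa> * (norm x)\<^sup>2)" for x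
      proof -
        have "(norm (x - v r))\<^sup>2 = (norm x)\<^sup>2 - 2 * (x \<bullet> v r) + (norm (v r))\<^sup>2"
          by (simp add: power2_norm_eq_inner algebra_simps inner_commute)
        then have "(norm x)\<^sup>2 - 2 * (norm (v r) * norm x) \<le> (norm (x - v r))\<^sup>2"
          using norm_cauchy_schwarz[of x "v r"] zero_le_power2[of "norm (v r)"]
          unfolding mult.commute[of "norm (v r)" "norm x"] by linarith
        from mult_left_mono[OF this, of \<kappa>] show ?thesis using \<kappa> by (simp add: algebra_simps)
      qed
    qed (intro borel_measurable_lebesgue_continuous continuous_intros)
    then show ?thesis by (simp add: L2_def e2)
  qed
  have eN: "(L2norm (\<lambda>x. complex_of_real (e r x)))\<^sup>2 = (\<integral>x. exp (- \<kappa> * (norm x)\<^sup>2) \<partial>(lebesgue :: 'a measure))" for r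
    using lebesgue_integral_translation[of "\<lambda>x::'a. exp (- \<kappa> * (norm x)\<^sup>2)" "v r"]
    by (simp add: L2norm_power2 e2)
  define N where "N = sqrt (\<integral>x. exp (- \<kappa> * (norm x)\<^sup>2) \<partial>(lebesgue :: 'a measure))"
  have eN': "L2norm (\<lambda>x. complex_of_real (e r x)) = N" for r
    unfolding N_def eN[of r, symmetric] by simp
  have N0: "N \<ge> 0" using eN'[of 0] L2norm_nonneg by metis
  have heL2: "(\<lambda>x. h x * of_real (e r x)) \<in> L2" for r
  proof (rule L2_bound[OF hL2])
    show "cmod (h x * complex_of_real (e r x)) \<le> cmod (h x)" for x
      using e1[where r = r and x = x] by (simp add: norm_mult mult_left_le abs_of_pos)
  qed measurable
  define I where "I = (\<lambda>r. L2norm (\<lambda>x. h x * of_real (e r x)))"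
  show thesis
  proof (rule that[of "\<lambda>r. I r * N" "L2norm h * N"])
    fix r
    have "(I r)\<^sup>2 \<le> (L2norm h)\<^sup>2"
      unfolding I_def L2norm_power2
    proof (rule integral_mono)
      show "(cmod (h x * of_real (e r x)))\<^sup>2 \<le> (cmod (h x))\<^sup>2" for x
        using e1[where r = r and x = x] by (intro power_mono) (simp_all add: norm_mult mult_left_le abs_of_pos)
    qed (use L2_D(2)[OF heL2] L2_D(2)[OF hL2] in auto)
    then have "I r \<le> L2norm h" by (rule power2_le_imp_le) simp
    then show "I r * N \<le> L2norm h * N" using N0 by (rule mult_right_mono)
  next
    fix c :: real assume c: "c \<noteq> 0"
    have "(\<lambda>n. \<integral>x. (cmod (h x * of_real (e (c * real n) x)))\<^sup>2 \<partial>lebesgue) \<longlonglongrightarrow> (\<integral>x. 0 \<partial>(lebesgue :: 'a measure))"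
    proof (rule integral_dominated_convergence)
      show "integrable lebesgue (\<lambda>x. (cmod (h x))\<^sup>2)" by (rule L2_D(2)[OF hL2])
      show "AE x in lebesgue. norm ((cmod (h x * of_real (e (c * real n) x)))\<^sup>2) \<le> (cmod (h x))\<^sup>2" for n
      proof (intro AE_I2)
        fix x
        have "(cmod (h x * of_real (e (c * real n) x)))\<^sup>2 \<le> (cmod (h x))\<^sup>2"
          using e1[where r = "c * real n" and x = x] by (intro power_mono) (simp_all add: norm_mult mult_left_le abs_of_pos)
        then show "norm ((cmod (h x * of_real (e (c * real n) x)))\<^sup>2) \<le> (cmod (h x))\<^sup>2" by simp
      qed
      show "AE x in lebesgue. (\<lambda>n. (cmod (h x * of_real (e (c * real n) x)))\<^sup>2) \<longlonglongrightarrow> 0"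
      proof (intro AE_I2)
        fix x
        have "(\<lambda>n. e (c * real n) x) \<longlonglongrightarrow> 0"
        \<comment> \<open>The centre recedes at linear speed \<open>d\<close>, so eventually its
          distance to the fixed x is at least d n - norm x, which is then nonnegative and may be
          squared.\<close>
        proof (rule tendsto_sandwich[of "\<lambda>_. 0"])
          have nv: "norm (v (c * real n)) = \<bar>c\<bar> / (2 * \<kappa>) * real n" for n
            using \<kappa> \<omega> by (simp add: v_def abs_mult)
          define d where "d = \<bar>c\<bar> / (2 * \<kappa>)"
          have d: "d > 0" using c \<kappa> by (simp add: d_def)
          show "(\<lambda>n. exp (- (\<kappa> / 2) * (d * real n - norm x)\<^sup>2)) \<longlonglongrightarrow> 0"
            using d \<kappa> by real_asymp
          have "\<forall>\<^sub>F n in sequentially. norm x / d \<le> real n"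
            using filterlim_real_sequentially by (simp add: filterlim_at_top)
          then show "\<forall>\<^sub>F n in sequentially. e (c * real n) x \<le> exp (- (\<kappa> / 2) * (d * real n - norm x)\<^sup>2)"
          proof eventually_elim
            case (elim n)
            have "0 \<le> d * real n - norm x" using elim d by (simp add: field_simps)
            moreover have "d * real n - norm x \<le> norm (x - v (c * real n))"
              using norm_triangle_ineq2[of "v (c * real n)" x] nv[of n] by (simp add: d_def norm_minus_commute)
            ultimately have "(d * real n - norm x)\<^sup>2 \<le> (norm (x - v (c * real n)))\<^sup>2"
              by (intro power_mono)
            then show ?case using \<kappa> by (simp add: e_def mult_left_mono)
          qed
        qed (auto intro!: always_eventually less_imp_le e1)
        then have "(\<lambda>n. (cmod (h x * of_real (e (c * real n) x)))\<^sup>2) \<longlonglongrightarrow> (cmod (h x * of_real 0))\<^sup>2"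
          by (intro tendsto_intros)
        then show "(\<lambda>n. (cmod (h x * of_real (e (c * real n) x)))\<^sup>2) \<longlonglongrightarrow> 0" by simp
      qed
    qed measurable
    then have "(\<lambda>n. I (c * real n)) \<longlonglongrightarrow> sqrt 0"
      unfolding I_def L2norm_def by (intro tendsto_real_sqrt) simp
    from tendsto_mult[OF this tendsto_const[of N]] show "(\<lambda>n. I (c * real n) * N) \<longlonglongrightarrow> 0" by simp
  next
    fix \<zeta> :: complex
    define r where "r = Re \<zeta>"
    have split: "cmod (f x * coherent \<omega> \<zeta> x) = exp (1 / (4 * a + 1) * r\<^sup>2) * (cmod (h x * of_real (e r x)) * cmod (complex_of_real (e r x)))" for x
    proof -
      have "(norm (x - v r))\<^sup>2 = (norm x)\<^sup>2 - 2 * (x \<bullet> v r) + (norm (v r))\<^sup>2"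
        by (simp add: power2_norm_eq_inner algebra_simps inner_commute)
      also have "x \<bullet> v r = r / (2 * \<kappa>) * (x \<bullet> \<omega>)" by (simp add: v_def)
      also have "(norm (v r))\<^sup>2 = r\<^sup>2 / (4 * \<kappa>\<^sup>2)" using \<omega> by (simp add: v_def power_mult_distrib power_divide)
      finally have "\<kappa> * (norm (x - v r))\<^sup>2 = \<kappa> * (norm x)\<^sup>2 - r * (x \<bullet> \<omega>) + r\<^sup>2 / (4 * \<kappa>)"
        using \<kappa> by (simp add: field_simps power2_eq_square)
      moreover have "r\<^sup>2 / (4 * \<kappa>) = 1 / (4 * a + 1) * r\<^sup>2" by (simp add: \<kappa>_def algebra_simps)
      ultimately have ex: "1 / (4 * a + 1) * r\<^sup>2 + (a * (norm x)\<^sup>2 + - \<kappa> * (norm (x - v r))\<^sup>2) = r * (x \<bullet> \<omega>) - (norm x)\<^sup>2 / 4"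
        by (simp add: \<kappa>_def algebra_simps)
      have "cmod (h x * of_real (e r x)) * cmod (complex_of_real (e r x)) = exp (a * (norm x)\<^sup>2) * cmod (f x) * (e r x)\<^sup>2"
        using e1[of r x] by (simp add: h_def norm_mult power2_eq_square)
      also have "exp (1 / (4 * a + 1) * r\<^sup>2) * \<dots> = cmod (f x) * exp (1 / (4 * a + 1) * r\<^sup>2 + (a * (norm x)\<^sup>2 + - \<kappa> * (norm (x - v r))\<^sup>2))"
        unfolding e2 exp_add by (simp only: mult_ac)
      also have "\<dots> = cmod (f x * coherent \<omega> \<zeta> x)"
        by (simp only: ex norm_mult[of "f x"] cmod_coherent r_def[symmetric])
      finally show ?thesis by (rule sym)
    qed
    have "cmod (\<integral>x. f x * coherent \<omega> \<zeta> x \<partial>lebesgue) \<le> (\<integral>x. cmod (f x * coherent \<omega> \<zeta> x) \<partial>lebesgue)"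
      by (rule integral_norm_bound)
    also have "\<dots> \<le> exp (1 / (4 * a + 1) * r\<^sup>2) * (I r * N)"
      unfolding split integral_mult_right_zero I_def eN'[of r, symmetric]
      by (intro mult_left_mono L2_Cauchy_Schwarz heL2 eL2) auto
    finally have "cmod (\<integral>x. f x * coherent \<omega> \<zeta> x \<partial>lebesgue) \<le> exp (1 / (4 * a + 1) * r\<^sup>2) * (I r * N)" .
    from mult_left_mono[OF this, of "exp (- Re (\<zeta>\<^sup>2) / 2)"]
    have "cmod (bargmann f \<omega> \<zeta>) \<le> exp (- Re (\<zeta>\<^sup>2) / 2) * (exp (1 / (4 * a + 1) * r\<^sup>2) * (I r * N))"
      by (simp add: bargmann_def norm_mult)
    also have "\<dots> = I r * N * (exp (1 / (4 * a + 1) * r\<^sup>2) * exp (- Re (\<zeta>\<^sup>2) / 2))"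
      by (simp only: mult_ac)
    also have "exp (1 / (4 * a + 1) * r\<^sup>2) * exp (- Re (\<zeta>\<^sup>2) / 2) = exp (1 / (4 * a + 1) * r\<^sup>2 - Re (\<zeta>\<^sup>2) / 2)"
      by (simp flip: exp_add)
    finally show "cmod (bargmann f \<omega> \<zeta>) \<le> I (Re \<zeta>) * N * exp (1 / (4 * a + 1) * (Re \<zeta>)\<^sup>2 - Re (\<zeta>\<^sup>2) / 2)"
      unfolding r_def .
  qed
qed

text \<open>For imaginary \<zeta> a coherent state is the ground state times a character, so the
  values at \<zeta> = \<i> r over all unit \<omega> determine the Fourier transform of f times a
  nowhere vanishing Gaussian. The frequency 0 has no direction and is reached with r = 0.\<close>

lemma bargmann_zero_imp_AE_zero:
  fixes f :: "'a::euclidean_space \<Rightarrow> complex"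
  assumes f: "f \<in> L2" and z: "\<And>\<omega> \<zeta>. norm \<omega> = 1 \<Longrightarrow> bargmann f \<omega> \<zeta> = 0"
  shows "AE x in lebesgue. f x = 0"
proof -
  have "AE x in lebesgue. f x * coherent 0 0 x = 0"
  proof (rule fourier_uniqueness)
    show "integrable lebesgue (\<lambda>x. f x * coherent 0 0 x)"
      by (intro L2_integrable_mult f coherent_L2)
    fix \<xi> :: 'a
    obtain \<omega> r where \<omega>: "norm \<omega> = 1" "\<xi> = r *\<^sub>R \<omega>"
    proof (cases "\<xi> = 0")
      case True
      obtain b :: 'a where "b \<in> Basis" using nonempty_Basis by blast
      then show ?thesis using that[of b 0] True by simp
    next
      case False
      then show ?thesis using that[of "(1 / norm \<xi>) *\<^sub>R \<xi>" "norm \<xi>"] by simp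
    qed
    have "coherent 0 0 x * iexp (x \<bullet> \<xi>) = coherent \<omega> (\<i> * of_real r) x" for x
      unfolding coherent_def exp_add[symmetric]
      by (rule arg_cong[of _ _ exp]) (simp add: \<omega>(2))
    then show "(\<integral>x. f x * coherent 0 0 x * iexp (x \<bullet> \<xi>) \<partial>lebesgue) = 0"
      using z[OF \<omega>(1), of "\<i> * of_real r"] by (simp add: bargmann_def mult.assoc)
  qed
  then show ?thesis by (simp add: coherent_def)
qed

lemma critical_decay_imp_bargmann_zero:
  fixes u\<^sub>0 :: "'a::euclidean_space \<Rightarrow> complex"
  assumes U: "harmonic_oscillator_group U" and u0: "u\<^sub>0 \<in> L2" and a: "a > 0" and b: "b > 0"
    and d0: "(\<lambda>x. of_real (exp (a * (norm x)\<^sup>2)) * u\<^sub>0 x) \<in> L2"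
    and ds: "(\<lambda>x. of_real (exp (b * (norm x)\<^sup>2)) * U s u\<^sub>0 x) \<in> L2"
    and crit: "a * b * (sin s)\<^sup>2 = 1 / 16" and \<omega>: "norm \<omega> = 1"
  shows "bargmann u\<^sub>0 \<omega> \<zeta> = 0"
proof -
  have un: "unitary_op (U s)" using U by (simp add: harmonic_oscillator_group_def unitary_group_def)
  have us: "U s u\<^sub>0 \<in> L2" using unitary_opD(1)[OF un u0] .
  define \<alpha> where "\<alpha> = 1 / (4 * a + 1)"
  define \<beta> where "\<beta> = 1 / (4 * b + 1)"
  have \<alpha>: "0 < \<alpha>" "\<alpha> < 1" "1 - \<alpha> = 4 * a * \<alpha>" using a by (auto simp: \<alpha>_def field_simps)
  have \<beta>: "0 < \<beta>" "\<beta> < 1" "1 - \<beta> = 4 * b * \<beta>" using b by (auto simp: \<beta>_def field_simps)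
  have "(1 - \<alpha>) * (1 - \<beta>) * (sin s)\<^sup>2 = 16 * (a * b * (sin s)\<^sup>2) * (\<alpha> * \<beta>)"
    unfolding \<alpha>(3) \<beta>(3) by (simp add: mult_ac)
  then have crit': "(1 - \<alpha>) * (1 - \<beta>) * (sin s)\<^sup>2 = \<alpha> * \<beta>" unfolding crit by simp
  obtain J C where J: "\<And>r. J r \<le> C" "\<And>c. c \<noteq> 0 \<Longrightarrow> (\<lambda>n. J (c * real n)) \<longlonglongrightarrow> 0"
    "\<And>\<zeta>. cmod (bargmann u\<^sub>0 \<omega> \<zeta>) \<le> J (Re \<zeta>) * exp (\<alpha> * (Re \<zeta>)\<^sup>2 - Re (\<zeta>\<^sup>2) / 2)"
    by (rule bargmann_growth[OF u0 a d0 \<omega>, folded \<alpha>_def]) (rule that)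
  obtain J' C' where J': "\<And>r. J' r \<le> C'"
    "\<And>\<zeta>. cmod (bargmann (U s u\<^sub>0) \<omega> \<zeta>) \<le> J' (Re \<zeta>) * exp (\<beta> * (Re \<zeta>)\<^sup>2 - Re (\<zeta>\<^sup>2) / 2)"
    by (rule bargmann_growth[OF us b ds \<omega>, folded \<beta>_def]) (rule that)
  \<comment> \<open>The lemma on entire functions takes one constant for both bounds, hence the
    maximum.\<close>
  have bd1: "cmod (bargmann u\<^sub>0 \<omega> \<zeta>) \<le> max C C' * exp (\<alpha> * (Re \<zeta>)\<^sup>2 - Re (\<zeta>\<^sup>2) / 2)" for \<zeta>
    using J(1)[of "Re \<zeta>"] by (intro order_trans[OF J(3)] mult_right_mono) auto
  have bd2: "cmod (bargmann u\<^sub>0 \<omega> \<zeta>) \<le> max C C' * exp (\<beta> * (Re (cis s * \<zeta>))\<^sup>2 - Re ((cis s * \<zeta>)\<^sup>2) / 2)" for \<zeta>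
  proof -
    have "cmod (bargmann u\<^sub>0 \<omega> \<zeta>) = cmod (bargmann (U s u\<^sub>0) \<omega> (cis s * \<zeta>))"
      by (subst bargmann_rotation[OF U u0 \<omega>, of _ s]) (simp add: norm_mult)
    also have "\<dots> \<le> max C C' * exp (\<beta> * (Re (cis s * \<zeta>))\<^sup>2 - Re ((cis s * \<zeta>)\<^sup>2) / 2)"
      using J'(1)[of "Re (cis s * \<zeta>)"] by (intro order_trans[OF J'(2)] mult_right_mono) (auto simp del: times_complex.sel)
    finally show ?thesis .
  qed
  obtain \<tau> c k where \<tau>: "cmod \<tau> = 1" "Re \<tau> \<noteq> 0" "\<And>z. bargmann u\<^sub>0 \<omega> (\<tau> * z) = k * exp (c * z\<^sup>2)"
    "\<And>r. Re (c * (complex_of_real r)\<^sup>2) = \<alpha> * (Re (\<tau> * of_real r))\<^sup>2 - Re ((\<tau> * of_real r)\<^sup>2) / 2"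
    by (rule critical_growth_imp_gaussian[OF bargmann_holomorphic[OF u0] \<alpha>(1,2) \<beta>(1,2) crit' bd1 bd2]) (rule that)
  \<comment> \<open>At z = n the Gaussian attains the growth allowed by the first bound, so the
    exponentials cancel and only \<open>J\<close> remains; it tends to 0 because Re \<tau> \<noteq>
    0.\<close>
  have "cmod k \<le> J (Re \<tau> * real n)" for n
  proof -
    have "cmod k * exp (Re (c * (complex_of_real (real n))\<^sup>2)) \<le> J (Re \<tau> * real n) * exp (Re (c * (complex_of_real (real n))\<^sup>2))"
      using J(3)[of "\<tau> * of_real (real n)"] unfolding \<tau>(3) \<tau>(4)[symmetric] norm_mult norm_exp_eq_Re by simp
    then show ?thesis by simp
  qed
  then have "cmod k \<le> 0"
    by (intro tendsto_lowerbound[OF J(2)[OF \<tau>(2)]]) auto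
  moreover have "\<tau> \<noteq> 0" using \<tau>(1) by auto
  ultimately show ?thesis using \<tau>(3)[of "\<zeta> / \<tau>"] by simp
qed

theorem corollary1p2:
  fixes U :: "real \<Rightarrow> (real ^ 'm \<Rightarrow> complex) \<Rightarrow> (real ^ 'm \<Rightarrow> complex)"
    and u\<^sub>0 :: "real ^ 'm \<Rightarrow> complex"
    and u :: "real ^ 'm \<Rightarrow> real \<Rightarrow> complex"
    and s a b :: real
  assumes "harmonic_oscillator_group U"
    and "u\<^sub>0 \<in> L2"
    and "\<forall>t. AE x in lebesgue. u x t = U t u\<^sub>0 x"
    and "a > 0" and "b > 0"
    and "(\<lambda>x. of_real (exp (a * (norm x)\<^sup>2)) * u x 0) \<in> L2"
    and "(\<lambda>x. of_real (exp (b * (norm x)\<^sup>2)) * u x s) \<in> L2"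
    and "a * b * (sin s)\<^sup>2 \<ge> 1 / 16"
  shows "\<forall>t. AE x in lebesgue. u x t = 0"
proof -
  have UG: "unitary_group U" using assms(1) by (simp add: harmonic_oscillator_group_def)
  then have un: "unitary_op (U t)" for t by (simp add: unitary_group_def)
  have UL: "U t u\<^sub>0 \<in> L2" for t using unitary_opD(1)[OF un assms(2)] .
  \<comment> \<open>One transfer for two purposes: passing from \<open>u\<close> to an almost
    everywhere equal function, and lowering the exponent of the weight.\<close>
  have cong: "(\<lambda>x. complex_of_real (exp (c * (norm x)\<^sup>2)) * g x) \<in> L2"
    if "(\<lambda>x. complex_of_real (exp (d * (norm x)\<^sup>2)) * f x) \<in> L2" "g \<in> L2" "AE x in lebesgue. f x = g x" "c \<le> d" for c d and f g :: "real ^ 'm \<Rightarrow> complex"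
  proof -
    have "(\<lambda>x::real ^ 'm. complex_of_real (exp (c * (norm x)\<^sup>2))) \<in> borel_measurable lebesgue"
      by (intro borel_measurable_lebesgue_continuous continuous_intros)
    then have m[measurable]: "(\<lambda>x. complex_of_real (exp (c * (norm x)\<^sup>2)) * g x) \<in> borel_measurable lebesgue"
      using L2_D(1)[OF that(2)] by simp
    have "AE x in lebesgue. norm ((cmod (complex_of_real (exp (c * (norm x)\<^sup>2)) * g x))\<^sup>2) \<le> norm ((cmod (complex_of_real (exp (d * (norm x)\<^sup>2)) * f x))\<^sup>2)"
      using that(3)
    proof eventually_elim
      case (elim x)
      have "exp (c * (norm x)\<^sup>2) \<le> exp (d * (norm x)\<^sup>2)" using that(4) by (simp add: mult_right_mono)
      then show ?case using elim by (auto simp: norm_mult intro!: power_mono mult_right_mono)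
    qed
    then have "integrable lebesgue (\<lambda>x. (cmod (complex_of_real (exp (c * (norm x)\<^sup>2)) * g x))\<^sup>2)"
      by (intro Bochner_Integration.integrable_bound[OF L2_D(2)[OF that(1)]]) measurable
    with m show ?thesis by (simp add: L2_def)
  qed
  have bs: "b * (sin s)\<^sup>2 > 0"
  proof -
    have "sin s \<noteq> 0" using assms(8) by auto
    then show ?thesis using assms(5) by simp
  qed
  \<comment> \<open>The exponent that gives equality; \<open>a' \<le> a\<close> is the last
    hypothesis, and a weaker weight preserves square integrability. It is well defined since sin s =
    0 would contradict that hypothesis.\<close>
  define a' where "a' = 1 / (16 * (b * (sin s)\<^sup>2))"
  have a': "a' > 0" "a' \<le> a" "a' * b * (sin s)\<^sup>2 = 1 / 16"
    using bs assms(8) by (auto simp: a'_def field_simps)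
  have "AE x in lebesgue. U 0 u\<^sub>0 x = u\<^sub>0 x"
    using UG assms(2) unfolding unitary_group_def by blast
  with assms(3)[rule_format, of 0] have "AE x in lebesgue. u x 0 = u\<^sub>0 x"
    by eventually_elim simp
  from cong[OF assms(6) assms(2) this a'(2)]
  have d0: "(\<lambda>x. complex_of_real (exp (a' * (norm x)\<^sup>2)) * u\<^sub>0 x) \<in> L2" .
  from cong[OF assms(7) UL assms(3)[rule_format, of s] order_refl]
  have ds: "(\<lambda>x. complex_of_real (exp (b * (norm x)\<^sup>2)) * U s u\<^sub>0 x) \<in> L2" .
  have "AE x in lebesgue. u\<^sub>0 x = 0"
    using critical_decay_imp_bargmann_zero[OF assms(1,2) a'(1) assms(5) d0 ds a'(3)]
    by (intro bargmann_zero_imp_AE_zero assms(2)) auto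
  then have "L2norm u\<^sub>0 = 0"
    unfolding L2norm_def by (subst integral_eq_zero_AE) auto
  then have zero: "AE x in lebesgue. U t u\<^sub>0 x = 0" for t
    using unitary_opD(3)[OF un assms(2)] by (intro L2norm_eq_0 UL) simp
  show ?thesis
  proof
    fix t
    show "AE x in lebesgue. u x t = 0"
      using assms(3)[rule_format, of t] zero[of t] by eventually_elim simp
  qed
qed

end
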